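(* Let $G$ be a group with finite generating set $S$ and let $Q$ be a quasi-normal subgroup of $G$. Then the graph $\Lambda(S,Q,G)$ has $0$, $1$, $2$ or an uncountable number of ends, and this number is independent of the choice of the finite generating set $S$ of $G$.
   Context: For a subgroup $H$ of a group $G$, the commensurator of $H$ in $G$ is $Comm(H,G)=\{g\in G : gHg^{-1}\cap H \text{ has finite index in both } H \text{ and } gHg^{-1}\}$. A subgroup $Q$ of $G$ is quasi-normal in $G$ if $Comm(Q,G)=G$. For a finite generating set $S$ of $G$ and a subgroup $H$, $\Lambda(S,H,G)$ is the graph whose vertices are the left cosets $gH$, with a directed edge labeled $s\in S$ from $gH$ to $fH$ whenever $gh_1sh_2=f$ for some $h_1,h_2\in H$ (equivalently, in the Cayley graph of $G$ with respect to $S$ there is an edge labeled $s$ with initial point in $gH$ and end point in $fH$). When $Q$ is quasi-normal in $G$, $\Lambda(S,Q,G)$ is a connected locally finite graph. For a connected locally finite graph $X$, the set of ends of $X$ is the set of equivalence classes of proper infinite edge paths $r:[0,\infty)\to X$ (proper: preimages of compact sets are compact), where $r$ and $r'$ are equivalent if for every compact $C\subset X$ there is an edge path in $X-C$ from the image of $r$ to the image of $r'$. The number of ends is the cardinality of this set. *)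

theory Defs
  imports
    "HOL-Analysis.Analysis"
    "HOL-Algebra.Left_Coset"
    "HOL-Algebra.Generated_Groups"
    "HOL-Library.Equipollence"
    "Graph_Theory.Arc_Walk"
begin

section \<open>Quasi-normal subgroups\<close>

definition finite_index :: "('a, 'b) monoid_scheme \<Rightarrow> 'a set \<Rightarrow> 'a set \<Rightarrow> bool" where
  "finite_index G K H \<longleftrightarrow>
     subgroup K (G\<lparr>carrier := H\<rparr>) \<and> finite (rcosets\<^bsub>G\<lparr>carrier := H\<rparr>\<^esub> K)"

definition conj_subgroup :: "('a, 'b) monoid_scheme \<Rightarrow> 'a \<Rightarrow> 'a set \<Rightarrow> 'a set" where
  "conj_subgroup G g H = g <#\<^bsub>G\<^esub> H #>\<^bsub>G\<^esub> inv\<^bsub>G\<^esub> g"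

definition commensurator :: "('a, 'b) monoid_scheme \<Rightarrow> 'a set \<Rightarrow> 'a set" where
  "commensurator G H = {g \<in> carrier G.
     finite_index G (conj_subgroup G g H \<inter> H) H \<and>
     finite_index G (conj_subgroup G g H \<inter> H) (conj_subgroup G g H)}"

definition quasi_normal :: "('a, 'b) monoid_scheme \<Rightarrow> 'a set \<Rightarrow> bool" where
  "quasi_normal G Q \<longleftrightarrow> subgroup Q G \<and> commensurator G Q = carrier G"

definition finite_generating_set :: "('a, 'b) monoid_scheme \<Rightarrow> 'a set \<Rightarrow> bool" where
  "finite_generating_set G S \<longleftrightarrow> finite S \<and> S \<subseteq> carrier G \<and> generate G S = carrier G"


section \<open>The coset graph\<close>

text \<open>An edge is a triple (initial coset, label, terminal coset), so that distinct labels
  give distinct (parallel) edges, while each label contributes at most one edge from one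
  given coset to another.\<close>

definition coset_graph ::
  "'a set \<Rightarrow> 'a set \<Rightarrow> ('a, 'b) monoid_scheme \<Rightarrow> ('a set, 'a set \<times> 'a \<times> 'a set) pre_digraph"
  where
  "coset_graph S H G =
     \<lparr>verts = lcosets\<^bsub>G\<^esub> H,
      arcs = {(g <#\<^bsub>G\<^esub> H, s, f <#\<^bsub>G\<^esub> H) | g s f.
                g \<in> carrier G \<and> s \<in> S \<and> f \<in> carrier G \<and>
                (\<exists>h1\<in>H. \<exists>h2\<in>H. g \<otimes>\<^bsub>G\<^esub> h1 \<otimes>\<^bsub>G\<^esub> s \<otimes>\<^bsub>G\<^esub> h2 = f)},
      tail = (\<lambda>(A, s, B). A),
      head = (\<lambda>(A, s, B). B)\<rparr>"


section \<open>Topological realization of a graph\<close>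

text \<open>\<open>Inner e t\<close> with \<open>0 < t < 1\<close> is the point of the open edge \<open>e\<close> at distance \<open>t\<close> from
  its tail.\<close>

datatype ('v, 'e) graph_point = Vertex 'v | Inner 'e real

definition edge_map :: "('v, 'e) pre_digraph \<Rightarrow> 'e \<Rightarrow> real \<Rightarrow> ('v, 'e) graph_point" where
  "edge_map X e t =
     (if t = 0 then Vertex (tail X e) else if t = 1 then Vertex (head X e) else Inner e t)"

definition graph_points :: "('v, 'e) pre_digraph \<Rightarrow> ('v, 'e) graph_point set" where
  "graph_points X = Vertex ` verts X \<union> {Inner e t | e t. e \<in> arcs X \<and> 0 < t \<and> t < 1}"

text \<open>The usual weak (CW) topology: the quotient topology with respect to the vertices and
  the characteristic maps \<open>edge_map X e\<close> of all edges.\<close>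

definition realization :: "('v, 'e) pre_digraph \<Rightarrow> ('v, 'e) graph_point topology" where
  "realization X = topology (\<lambda>U. U \<subseteq> graph_points X \<and>
     (\<forall>e\<in>arcs X. openin (top_of_set {0..1}) {t \<in> {0..1}. edge_map X e t \<in> U}))"

lemma openin_realization:
  "openin (realization X) U \<longleftrightarrow> U \<subseteq> graph_points X \<and>
     (\<forall>e\<in>arcs X. openin (top_of_set {0..1}) {t \<in> {0..1}. edge_map X e t \<in> U})"
proof -
  let ?P = "\<lambda>U. U \<subseteq> graph_points X \<and>
     (\<forall>e\<in>arcs X. openin (top_of_set {0..1}) {t \<in> {0..1}. edge_map X e t \<in> U})"
  have "istopology ?P"
    unfolding istopology_def
  proof (intro conjI allI impI)
    fix S T assume S: "?P S" and T: "?P T"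
    show "S \<inter> T \<subseteq> graph_points X" using S by blast
    show "\<forall>e\<in>arcs X. openin (top_of_set {0..1}) {t \<in> {0..1}. edge_map X e t \<in> S \<inter> T}"
    proof
      fix e assume e: "e \<in> arcs X"
      have "{t \<in> {0..1}. edge_map X e t \<in> S \<inter> T} =
        {t \<in> {0..1}. edge_map X e t \<in> S} \<inter> {t \<in> {0..1}. edge_map X e t \<in> T}" by blast
      then show "openin (top_of_set {0..1}) {t \<in> {0..1}. edge_map X e t \<in> S \<inter> T}"
        using S T e by (simp only: openin_Int)
    qed
  next
    fix K assume K: "\<forall>U\<in>K. ?P U"
    show "\<Union>K \<subseteq> graph_points X" using K by blast
    show "\<forall>e\<in>arcs X. openin (top_of_set {0..1}) {t \<in> {0..1}. edge_map X e t \<in> \<Union>K}"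
    proof
      fix e assume e: "e \<in> arcs X"
      have "{t \<in> {0..1}. edge_map X e t \<in> \<Union>K} =
        \<Union>((\<lambda>U. {t \<in> {0..1}. edge_map X e t \<in> U}) ` K)" by blast
      moreover have "openin (top_of_set {0..1}) (\<Union>((\<lambda>U. {t \<in> {0..1}. edge_map X e t \<in> U}) ` K))"
        using K e by (intro openin_Union) blast
      ultimately show "openin (top_of_set {0..1}) {t \<in> {0..1}. edge_map X e t \<in> \<Union>K}"
        by (simp only:)
    qed
  qed
  then show ?thesis
    by (simp add: realization_def)
qed


section \<open>Edge paths\<close>

text \<open>An edge path may traverse edges in both directions. We represent it as a directed walk
  in the graph of oriented edges, where \<open>(e, True)\<close> is \<open>e\<close> traversed from tail to head and
  \<open>(e, False)\<close> is \<open>e\<close> traversed from head to tail.\<close>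

definition oriented_graph :: "('v, 'e) pre_digraph \<Rightarrow> ('v, 'e \<times> bool) pre_digraph" where
  "oriented_graph X =
     \<lparr>verts = verts X,
      arcs = arcs X \<times> UNIV,
      tail = (\<lambda>(e, b). if b then tail X e else head X e),
      head = (\<lambda>(e, b). if b then head X e else tail X e)\<rparr>"

fun oriented_edge_map ::
  "('v, 'e) pre_digraph \<Rightarrow> 'e \<times> bool \<Rightarrow> real \<Rightarrow> ('v, 'e) graph_point" where
  "oriented_edge_map X (e, b) t = edge_map X e (if b then t else 1 - t)"

definition edge_path ::
  "('v, 'e) pre_digraph \<Rightarrow> 'v \<Rightarrow> ('e \<times> bool) list \<Rightarrow> 'v \<Rightarrow> bool" where
  "edge_path X u p v \<longleftrightarrow> pre_digraph.awalk (oriented_graph X) u p v"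

text \<open>The start vertex is included explicitly because \<open>p\<close> may be empty.\<close>

definition edge_path_image ::
  "('v, 'e) pre_digraph \<Rightarrow> 'v \<Rightarrow> ('e \<times> bool) list \<Rightarrow> ('v, 'e) graph_point set" where
  "edge_path_image X u p = insert (Vertex u) (\<Union>d\<in>set p. oriented_edge_map X d ` {0..1})"

definition infinite_edge_path :: "('v, 'e) pre_digraph \<Rightarrow> (nat \<Rightarrow> 'e \<times> bool) \<Rightarrow> bool" where
  "infinite_edge_path X r \<longleftrightarrow>
     (\<forall>n. r n \<in> arcs (oriented_graph X) \<and>
          head (oriented_graph X) (r n) = tail (oriented_graph X) (r (Suc n)))"

text \<open>The map \<open>[0,\<infinity>) \<rightarrow> X\<close> that traverses the \<open>n\<close>-th edge during the time interval \<open>[n, n + 1]\<close>.\<close>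

definition ray_map ::
  "('v, 'e) pre_digraph \<Rightarrow> (nat \<Rightarrow> 'e \<times> bool) \<Rightarrow> real \<Rightarrow> ('v, 'e) graph_point" where
  "ray_map X r t = oriented_edge_map X (r (nat \<lfloor>t\<rfloor>)) (frac t)"

lemma ray_map_of_nat: "ray_map X r (real n) = Vertex (tail (oriented_graph X) (r n))"
  by (cases "r n") (simp add: ray_map_def oriented_graph_def edge_map_def frac_def)


section \<open>Ends\<close>

definition proper_rays :: "('v, 'e) pre_digraph \<Rightarrow> (nat \<Rightarrow> 'e \<times> bool) set" where
  "proper_rays X = {r. infinite_edge_path X r \<and>
     (\<forall>C. compactin (realization X) C \<longrightarrow> compact {t. 0 \<le> t \<and> ray_map X r t \<in> C})}"

definition end_rel ::
  "('v, 'e) pre_digraph \<Rightarrow> ((nat \<Rightarrow> 'e \<times> bool) \<times> (nat \<Rightarrow> 'e \<times> bool)) set" where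
  "end_rel X = {(r, r'). r \<in> proper_rays X \<and> r' \<in> proper_rays X \<and>
     (\<forall>C. compactin (realization X) C \<longrightarrow>
        (\<exists>u p v. edge_path X u p v \<and> edge_path_image X u p \<inter> C = {} \<and>
                 Vertex u \<in> ray_map X r ` {0..} \<and> Vertex v \<in> ray_map X r' ` {0..}))}"

definition graph_ends :: "('v, 'e) pre_digraph \<Rightarrow> (nat \<Rightarrow> 'e \<times> bool) set set" where
  "graph_ends X = proper_rays X // end_rel X"

end

theory Submission
  imports Defs
begin

text \<open>
  An end is represented by a sequence of vertices that leaves every finite set and whose tail,
  for every finite \<open>F\<close>, lies in one component of the complement of \<open>F\<close>. This data, unlike the
  rays, is literally the same for two adjacency relations that bound each other's distances, as
  those of two finite generating sets do; each such sequence is equivalent to a ray by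
  concatenating paths.

  By commensurability the coset graph is locally finite, and left multiplication makes it
  vertex-transitive. If three ends are separated by a ball, translates of this ball can be placed
  in any component containing an end. Diagonalising against a list of ends with such
  translates, one obtains a nested sequence of components whose end is not in the list.
\<close>

section \<open>Ends of a locally finite relation\<close>

text \<open>Topology reduces to finite vertex sets: a compact subset of the realization contains
  finitely many vertices and meets finitely many open edges. So properness of a ray says that each
  vertex is visited finitely often, and equivalence of rays says that their late vertices are
  connected off every finite set. Commensurability is used to make each coset have finitely many
  neighbours. Local finiteness then keeps every ball finite, so that a finite set may be enlarged to
  a ball and still be a legitimate test set; both the diagonal argument and the change of generators
  depend on this. Three is the threshold because a new end must avoid two things at once: the listed
  end that is to be excluded, and the side of the translated ball on which the old ball lies. Three
  separated directions leave one free; two need not. Vertex sequences also simplify the diagonal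
  argument: one vertex chosen from each nested component is already a representative of an end, and
  no path through the choices has to be built.\<close>

text \<open>The relation is reflexive everywhere: a point of \<open>F\<close> is joined to itself
  and to nothing else. Hence if \<open>v\<close> is joined to no point of a set \<open>K\<close>,
  then in particular \<open>v\<close> lies outside \<open>K\<close>.\<close>

definition joined_off :: "'v rel \<Rightarrow> 'v set \<Rightarrow> 'v rel" where
  "joined_off E F = (E \<inter> (- F) \<times> (- F))\<^sup>*"

definition ev_joined :: "'v rel \<Rightarrow> 'v set \<Rightarrow> (nat \<Rightarrow> 'v) \<Rightarrow> (nat \<Rightarrow> 'v) \<Rightarrow> bool" where
  "ev_joined E F y z \<longleftrightarrow> (\<exists>N. \<forall>m\<ge>N. \<forall>n\<ge>N. (y m, z n) \<in> joined_off E F)"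

text \<open>The sequences of vertices that converge to an end; consecutive terms need not be adjacent.\<close>

definition end_seqs :: "'v set \<Rightarrow> 'v rel \<Rightarrow> (nat \<Rightarrow> 'v) set" where
  "end_seqs V E = {y. range y \<subseteq> V \<and>
     (\<forall>F. finite F \<longrightarrow> ev_joined E F y y \<and> (\<forall>\<^sub>F n in sequentially. y n \<notin> F))}"

definition seq_end_rel :: "'v set \<Rightarrow> 'v rel \<Rightarrow> ((nat \<Rightarrow> 'v) \<times> (nat \<Rightarrow> 'v)) set" where
  "seq_end_rel V E = {(y, z). y \<in> end_seqs V E \<and> z \<in> end_seqs V E \<and>
     (\<forall>F. finite F \<longrightarrow> ev_joined E F y z)}"

lemma joined_off_refl [simp]: "(x, x) \<in> joined_off E F"
  by (simp add: joined_off_def)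

lemma joined_off_trans: "(x, y) \<in> joined_off E F \<Longrightarrow> (y, z) \<in> joined_off E F \<Longrightarrow> (x, z) \<in> joined_off E F"
  unfolding joined_off_def by (rule rtrancl_trans)

lemma joined_off_edge: "(x, y) \<in> E \<Longrightarrow> x \<notin> F \<Longrightarrow> y \<notin> F \<Longrightarrow> (x, y) \<in> joined_off E F"
  unfolding joined_off_def by (rule r_into_rtrancl) simp

lemma joined_off_sym: "sym E \<Longrightarrow> (x, y) \<in> joined_off E F \<Longrightarrow> (y, x) \<in> joined_off E F"
  unfolding joined_off_def
  by (rule symD[OF sym_rtrancl]) (auto simp: sym_def)

lemma joined_off_antimono: "F \<subseteq> F' \<Longrightarrow> joined_off E F' \<subseteq> joined_off E F"
  unfolding joined_off_def by (rule rtrancl_mono) blast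

lemma joined_off_avoids: "(x, y) \<in> joined_off E F \<Longrightarrow> x \<notin> F \<Longrightarrow> y \<notin> F"
  unfolding joined_off_def by (induction rule: rtrancl_induct) auto

text \<open>Test sets \<open>F\<close> range over finite sets of the whole type, whereas balls
  exhaust only \<open>V\<close>; this bridges the two.\<close>

lemma joined_off_Int:
  assumes "E \<subseteq> V \<times> V"
  shows "joined_off E (F \<inter> V) = joined_off E F"
proof -
  have "E \<inter> (- (F \<inter> V)) \<times> (- (F \<inter> V)) = E \<inter> (- F) \<times> (- F)"
    using assms by blast
  then show ?thesis by (simp add: joined_off_def)
qed

text \<open>Each edge off \<open>F\<close> is mapped to an edge off \<open>F'\<close>. The preimage
  condition is restricted to \<open>V\<close> because translations are invertible only
  there.\<close>

lemma joined_off_hom: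
  assumes xy: "(x, y) \<in> joined_off E F" and E: "E \<subseteq> V \<times> V"
    and f: "\<And>a b. (a, b) \<in> E \<Longrightarrow> (f a, f b) \<in> E"
    and F: "\<And>v. v \<in> V \<Longrightarrow> f v \<in> F' \<Longrightarrow> v \<in> F"
  shows "(f x, f y) \<in> joined_off E F'"
  using xy[unfolded joined_off_def]
proof (induction rule: rtrancl_induct)
  case (step y z)
  have "(f y, f z) \<in> joined_off E F'"
    using step.hyps E F by (intro joined_off_edge f) auto
  with step.IH show ?case by (rule joined_off_trans)
qed simp

lemma ev_joined_sym: "sym E \<Longrightarrow> ev_joined E F y z \<Longrightarrow> ev_joined E F z y"
  unfolding ev_joined_def by (meson joined_off_sym)

lemma ev_joined_trans:
  assumes "ev_joined E F x y" "ev_joined E F y z"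
  shows "ev_joined E F x z"
proof -
  obtain N where N: "\<forall>m\<ge>N. \<forall>n\<ge>N. (x m, y n) \<in> joined_off E F"
    using assms(1) unfolding ev_joined_def by blast
  obtain M where M: "\<forall>m\<ge>M. \<forall>n\<ge>M. (y m, z n) \<in> joined_off E F"
    using assms(2) unfolding ev_joined_def by blast
  show ?thesis unfolding ev_joined_def
  proof (intro exI[of _ "max N M"] allI impI)
    fix m n assume *: "max N M \<le> m" "max N M \<le> n"
    show "(x m, z n) \<in> joined_off E F"
      by (rule joined_off_trans[of _ "y (max N M)"]) (use * N M in auto)
  qed
qed

lemma ev_joined_antimono: "F \<subseteq> F' \<Longrightarrow> ev_joined E F' y z \<Longrightarrow> ev_joined E F y z"
  unfolding ev_joined_def using joined_off_antimono[of F F' E] by blast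

lemma end_seqs_in: "y \<in> end_seqs V E \<Longrightarrow> y n \<in> V"
  by (auto simp: end_seqs_def)

lemma end_seqs_joined: "y \<in> end_seqs V E \<Longrightarrow> finite F \<Longrightarrow> ev_joined E F y y"
  by (auto simp: end_seqs_def)

lemma end_seqs_obtain:
  assumes "y \<in> end_seqs V E" "finite F" "finite F'"
  obtains N where "\<forall>m\<ge>N. y m \<notin> F'" "\<forall>m\<ge>N. \<forall>n\<ge>N. (y m, y n) \<in> joined_off E F"
proof -
  obtain N where N: "\<forall>m\<ge>N. \<forall>n\<ge>N. (y m, y n) \<in> joined_off E F"
    using assms unfolding end_seqs_def ev_joined_def by blast
  obtain M where M: "\<forall>n\<ge>M. y n \<notin> F'"
    using assms unfolding end_seqs_def eventually_sequentially by blast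
  show thesis using N M that[of "max N M"] by simp
qed

lemma equiv_seq_end_rel:
  assumes "sym E"
  shows "equiv (end_seqs V E) (seq_end_rel V E)"
proof (rule equivI)
  show "seq_end_rel V E \<subseteq> end_seqs V E \<times> end_seqs V E"
    by (auto simp: seq_end_rel_def)
  show "refl_on (end_seqs V E) (seq_end_rel V E)"
    by (auto simp: refl_on_def seq_end_rel_def end_seqs_joined)
  show "sym (seq_end_rel V E)"
    unfolding sym_def seq_end_rel_def using ev_joined_sym[OF assms] by blast
  show "trans (seq_end_rel V E)"
    by (rule transI) (auto simp: seq_end_rel_def intro: ev_joined_trans)
qed

lemma ev_joined_coarser:
  assumes "joined_off E' F' \<subseteq> joined_off E F" "ev_joined E' F' y z"
  shows "ev_joined E F y z"
  using assms unfolding ev_joined_def by blast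

section \<open>Balls in a connected, locally finite graph\<close>

locale lf_graph =
  fixes V :: "'v set" and E :: "'v rel"
  assumes edges: "E \<subseteq> V \<times> V"
    and sym: "sym E"
    and locally_finite: "finite (E `` {v})"
    and connected: "x \<in> V \<Longrightarrow> y \<in> V \<Longrightarrow> (x, y) \<in> E\<^sup>*"
begin

text \<open>This is the closed \<open>n\<close>-neighbourhood of \<open>A\<close> in the path
  metric: the reflexive closure admits all shorter paths too.\<close>

definition nbhd :: "'v set \<Rightarrow> nat \<Rightarrow> 'v set" where
  "nbhd A n = ((E\<^sup>=) ^^ n) `` A"

lemma nbhd_0 [simp]: "nbhd A 0 = A"
  by (auto simp: nbhd_def)

lemma nbhd_Suc: "nbhd A (Suc n) = nbhd A n \<union> E `` nbhd A n"
  by (auto simp: nbhd_def)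

lemma finite_nbhd: "finite A \<Longrightarrow> finite (nbhd A n)"
proof (induction n)
  case (Suc n)
  have "E `` nbhd A n = (\<Union>v\<in>nbhd A n. E `` {v})" by blast
  with Suc locally_finite show ?case by (simp add: nbhd_Suc)
qed simp

lemma nbhd_mono: "m \<le> n \<Longrightarrow> nbhd A m \<subseteq> nbhd A n"
  using lift_Suc_mono_le[of "nbhd A" m n] by (simp add: nbhd_Suc)

lemma nbhd_disjoint_sym:
  assumes "x \<notin> nbhd K n"
  shows "nbhd {x} n \<inter> K = {}"
proof -
  have "sym ((E\<^sup>=) ^^ n)"
  proof (induction n)
    case (Suc n)
    show ?case
    proof (rule symI)
      fix x z assume "(x, z) \<in> (E\<^sup>=) ^^ Suc n"
      then obtain y where "(x, y) \<in> (E\<^sup>=) ^^ n" "(y, z) \<in> E\<^sup>=" by auto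
      then have "(z, y) \<in> E\<^sup>=" "(y, x) \<in> (E\<^sup>=) ^^ n"
        using sym Suc.IH by (auto dest: symD)
      then show "(z, x) \<in> (E\<^sup>=) ^^ Suc n" by (rule relpow_Suc_I2)
    qed
  qed (simp add: sym_Id)
  then show ?thesis
    using assms by (auto simp: nbhd_def sym_def)
qed

text \<open>A path of length at most \<open>n\<close> starting at \<open>x\<close> stays inside the
  ball, hence off \<open>F\<close>.\<close>

lemma joined_off_nbhd:
  assumes "p \<in> nbhd {x} n" "nbhd {x} n \<inter> F = {}"
  shows "(x, p) \<in> joined_off E F"
  using assms
proof (induction n arbitrary: p)
  case (Suc n)
  then have disj: "nbhd {x} n \<inter> F = {}" by (auto simp: nbhd_Suc)
  consider "p \<in> nbhd {x} n" | q where "q \<in> nbhd {x} n" "(q, p) \<in> E"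
    using Suc.prems(1) by (auto simp: nbhd_Suc)
  then show ?case
  proof cases
    case 1 then show ?thesis using Suc.IH disj by blast
  next
    case 2
    then have "(x, q) \<in> joined_off E F" using Suc.IH disj by blast
    moreover have "(q, p) \<in> joined_off E F"
      using 2 disj Suc.prems by (intro joined_off_edge) auto
    ultimately show ?thesis by (rule joined_off_trans)
  qed
qed simp

text \<open>The lower bound \<open>k\<close> allows the radius to be forced above an earlier
  one.\<close>

lemma finite_subset_nbhd:
  assumes "finite F" "F \<subseteq> V" "x \<in> V"
  obtains n where "k \<le> n" "F \<subseteq> nbhd {x} n"
proof -
  have "\<exists>n. F \<subseteq> nbhd {x} n"
    using assms(1,2)
  proof (induction F)
    case (insert v F)
    then obtain n where n: "F \<subseteq> nbhd {x} n" by blast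
    have "(x, v) \<in> (E\<^sup>=)\<^sup>*" using connected assms insert by simp
    then obtain m where "v \<in> nbhd {x} m"
      unfolding nbhd_def using rtrancl_imp_relpow by fastforce
    then show ?case
      using n nbhd_mono[of n "max n m" "{x}"] nbhd_mono[of m "max n m" "{x}"]
      by (intro exI[of _ "max n m"]) auto
  qed simp
  then obtain n where "F \<subseteq> nbhd {x} n" by blast
  then show thesis
    using that[of "max k n"] nbhd_mono[of n "max k n" "{x}"] by auto
qed

text \<open>Each edge of \<open>E'\<close> is replaced by an \<open>E\<close>-path of length at most
  \<open>L\<close>. Such a path cannot reach \<open>F\<close> if it starts at distance more than
  \<open>L\<close> from \<open>F\<close>.\<close>

lemma joined_off_far:
  assumes E': "\<And>x y. (x, y) \<in> E' \<Longrightarrow> y \<in> nbhd {x} L"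
  shows "joined_off E' (nbhd F L) \<subseteq> joined_off E F"
proof -
  have "E' \<inter> (- nbhd F L) \<times> (- nbhd F L) \<subseteq> joined_off E F"
  proof clarify
    fix x y assume "(x, y) \<in> E'" "x \<notin> nbhd F L" "y \<notin> nbhd F L"
    then show "(x, y) \<in> joined_off E F"
      by (intro joined_off_nbhd[OF E'] nbhd_disjoint_sym)
  qed
  then show ?thesis
    unfolding joined_off_def by (rule rtrancl_subset_rtrancl)
qed

lemma exhaustion:
  assumes "finite F" "x \<in> V"
  obtains n where "F \<inter> V \<subseteq> nbhd {x} n"
  by (rule finite_subset_nbhd[of "F \<inter> V" x]) (use assms in auto)

lemma ev_joined_nbhd:
  assumes "F \<inter> V \<subseteq> K" "ev_joined E K y z"
  shows "ev_joined E F y z"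
proof -
  have "ev_joined E (F \<inter> V) y z" using ev_joined_antimono assms by blast
  then show ?thesis unfolding ev_joined_def joined_off_Int[OF edges] .
qed

text \<open>Follow a walk from \<open>v\<close> to \<open>x\<close>. Until it meets \<open>D\<close>
  it stays in the component of \<open>v\<close> off \<open>D\<close>, which contains no point of
  \<open>K\<close>; once it meets \<open>D\<close>, the second assumption supplies the rest of the
  way.\<close>

lemma joined_off_reach:
  assumes "(v, x) \<in> E\<^sup>*" "\<And>p. p \<in> D \<Longrightarrow> p \<notin> K \<and> (p, x) \<in> joined_off E K"
    and "\<And>k. k \<in> K \<Longrightarrow> (v, k) \<notin> joined_off E D"
  shows "(v, x) \<in> joined_off E K"
  using assms(1,3)
proof (induction rule: converse_rtrancl_induct)
  case (step v v')
  show ?case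
  proof (cases "v \<in> D")
    case True
    then show ?thesis using assms(2) by blast
  next
    case False
    have v: "v \<notin> K" using step.prems by force
    show ?thesis
    proof (cases "v' \<in> D")
      case True
      then show ?thesis
        using assms(2) joined_off_trans[OF joined_off_edge[OF step.hyps(1) v]] by blast
    next
      case v': False
      have vv': "(v, v') \<in> joined_off E D" using step.hyps False v' by (intro joined_off_edge)
      have *: "(v', k) \<notin> joined_off E D" if "k \<in> K" for k
        using step.prems[OF that] joined_off_trans[OF vv'] by blast
      then have "v' \<notin> K" by force
      then show ?thesis
        using joined_off_trans[OF joined_off_edge[OF step.hyps(1) v]] step.IH[OF *] by blast
    qed
  qed
qed simp

end

section \<open>Three ends of a vertex-transitive graph force uncountably many\<close>

text \<open>An automorphism is given together with its inverse: \<open>\<phi>\<close> carries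
  sequences and balls forward, and \<open>\<psi>\<close> pulls paths back to show that separation
  survives translation.\<close>

locale transitive_graph = lf_graph V E for V :: "'v set" and E +
  assumes transitive: "x \<in> V \<Longrightarrow> y \<in> V \<Longrightarrow> \<exists>\<phi> \<psi>. \<phi> x = y \<and>
    (\<forall>v\<in>V. \<phi> v \<in> V \<and> \<psi> v \<in> V \<and> \<psi> (\<phi> v) = v \<and> \<phi> (\<psi> v) = v) \<and>
    (\<forall>a b. (a, b) \<in> E \<longrightarrow> (\<phi> a, \<phi> b) \<in> E \<and> (\<psi> a, \<psi> b) \<in> E)"
begin

context
  fixes y1 y2 y3
  assumes ys: "y1 \<in> end_seqs V E" "y2 \<in> end_seqs V E" "y3 \<in> end_seqs V E"
    and separated: "(y1, y2) \<notin> seq_end_rel V E" "(y1, y3) \<notin> seq_end_rel V E"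
      "(y2, y3) \<notin> seq_end_rel V E"
begin

lemma separating_nbhd:
  assumes "x \<in> V"
  obtains L where "\<not> ev_joined E (nbhd {x} L) y1 y2" "\<not> ev_joined E (nbhd {x} L) y1 y3"
    "\<not> ev_joined E (nbhd {x} L) y2 y3"
proof -
  obtain F1 F2 F3 where F: "finite F1" "finite F2" "finite F3" "\<not> ev_joined E F1 y1 y2"
    "\<not> ev_joined E F2 y1 y3" "\<not> ev_joined E F3 y2 y3"
    using ys separated unfolding seq_end_rel_def by blast
  obtain L where L: "(F1 \<union> F2 \<union> F3) \<inter> V \<subseteq> nbhd {x} L"
    by (rule finite_subset_nbhd[of "(F1 \<union> F2 \<union> F3) \<inter> V" x]) (use F assms in auto)
  have "\<not> ev_joined E (nbhd {x} L) y z" if "\<not> ev_joined E F y z" "F \<subseteq> F1 \<union> F2 \<union> F3" for F y z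
  proof -
    have "\<not> ev_joined E (F \<inter> V) y z"
      using that(1) unfolding ev_joined_def joined_off_Int[OF edges] .
    then show ?thesis
      using ev_joined_antimono[of "F \<inter> V" "nbhd {x} L"] L that(2) by blast
  qed
  then show thesis using F that by (meson Un_upper1 Un_upper2 le_supI1)
qed

text \<open>A translate of a separating ball into the component containing the tail of \<open>y\<close> splits
  that component: of the three translated sequences, at most one is joined to \<open>e\<close> and at most
  one to the ball of radius \<open>M\<close>.\<close>

lemma splitting_step:
  assumes x0: "x0 \<in> V" and y: "y \<in> end_seqs V E"
  shows "\<exists>M' z. M < M' \<and> z \<in> end_seqs V E \<and> ev_joined E (nbhd {x0} M) z y \<and>
    \<not> ev_joined E (nbhd {x0} M') z e"
proof -
  let ?K = "nbhd {x0} M"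
  obtain L where L: "\<not> ev_joined E (nbhd {x0} L) y1 y2" "\<not> ev_joined E (nbhd {x0} L) y1 y3"
    "\<not> ev_joined E (nbhd {x0} L) y2 y3"
    using separating_nbhd[OF x0] by blast
  have finK: "finite ?K" by (simp add: finite_nbhd)
  \<comment> \<open>Beyond distance \<open>L\<close> from \<open>?K\<close>, so that the
    \<open>L\<close>-ball around \<open>y N\<close>, which receives the translated separating ball,
    misses \<open>?K\<close>.\<close>
  obtain N where N: "\<forall>m\<ge>N. y m \<notin> nbhd ?K L"
    "\<forall>m\<ge>N. \<forall>n\<ge>N. (y m, y n) \<in> joined_off E ?K"
    by (rule end_seqs_obtain[OF y finK finite_nbhd[OF finK, of L]])
  define x where "x = y N"
  have x: "x \<in> V" using end_seqs_in[OF y] by (simp add: x_def)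
  obtain \<phi> \<psi> where \<phi>: "\<phi> x0 = x" "\<And>v. v \<in> V \<Longrightarrow> \<phi> v \<in> V \<and> \<psi> v \<in> V \<and> \<psi> (\<phi> v) = v \<and> \<phi> (\<psi> v) = v"
    "\<And>a b. (a, b) \<in> E \<Longrightarrow> (\<phi> a, \<phi> b) \<in> E \<and> (\<psi> a, \<psi> b) \<in> E"
    using transitive[OF x0 x] by blast
  have nbhd_V: "nbhd {v} n \<subseteq> V" if "v \<in> V" for v n
    by (induction n) (use that edges in \<open>auto simp: nbhd_Suc\<close>)
  have \<phi>_nbhd: "\<phi> ` nbhd {x0} n \<subseteq> nbhd {x} n" for n
    by (induction n) (auto simp: nbhd_Suc \<phi>, (use \<phi>(3) in blast)+)
  define D where "D = \<phi> ` nbhd {x0} L"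
  have D_V: "D \<subseteq> V" using \<phi>(2) nbhd_V[OF x0] by (auto simp: D_def)
  have finD: "finite D" by (simp add: D_def finite_nbhd)
  have K_disj: "nbhd {x} L \<inter> ?K = {}"
    using N(1) nbhd_disjoint_sym by (simp add: x_def)
  have D_sub: "D \<subseteq> nbhd {x} L" using \<phi>_nbhd by (simp add: D_def)
  have D_x: "p \<notin> ?K \<and> (p, x) \<in> joined_off E ?K" if "p \<in> D" for p
    using that K_disj joined_off_nbhd[of p x L ?K] D_sub joined_off_sym[OF sym] by blast
  \<comment> \<open>The ball \<open>?K\<close> is connected and disjoint from \<open>D\<close>, so
    it lies in a single component off \<open>D\<close>; the constant sequence at \<open>x0\<close>
    can stand for all of \<open>?K\<close>.\<close>
  have K_x0: "(x0, k) \<in> joined_off E D" if "k \<in> ?K" for k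
    by (rule joined_off_nbhd[OF that]) (use K_disj D_sub in blast)
  have translate: "\<phi> \<circ> u \<in> end_seqs V E" if u: "u \<in> end_seqs V E" for u
    unfolding end_seqs_def
  proof (intro CollectI conjI allI impI)
    show "range (\<phi> \<circ> u) \<subseteq> V" using \<phi>(2) end_seqs_in[OF u] by auto
    fix F assume F: "finite (F :: 'v set)"
    have F': "finite (\<psi> ` F)" using F by simp
    have *: "v \<in> \<psi> ` F" if "v \<in> V" "\<phi> v \<in> F" for v
      using \<phi>(2)[OF that(1)] that(2) by force
    show "ev_joined E F (\<phi> \<circ> u) (\<phi> \<circ> u)"
    proof -
      obtain N where "\<forall>m\<ge>N. \<forall>n\<ge>N. (u m, u n) \<in> joined_off E (\<psi> ` F)"
        using end_seqs_joined[OF u F'] unfolding ev_joined_def by blast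
      moreover have "(\<phi> a, \<phi> b) \<in> joined_off E F" if "(a, b) \<in> joined_off E (\<psi> ` F)" for a b
        by (rule joined_off_hom[OF that edges]) (use \<phi>(3) * in blast)+
      ultimately have "\<forall>m\<ge>N. \<forall>n\<ge>N. (\<phi> (u m), \<phi> (u n)) \<in> joined_off E F" by blast
      then show ?thesis unfolding ev_joined_def by auto
    qed
    have "\<forall>\<^sub>F n in sequentially. u n \<notin> \<psi> ` F"
      using u F' unfolding end_seqs_def by blast
    then show "\<forall>\<^sub>F n in sequentially. (\<phi> \<circ> u) n \<notin> F"
      by (rule eventually_mono) (use * end_seqs_in[OF u] in auto)
  qed
  \<comment> \<open>A path off \<open>D\<close> between the translates is mapped by
    \<open>\<psi>\<close> to a path off the original ball.\<close>
  have sep: "\<not> ev_joined E D (\<phi> \<circ> u) (\<phi> \<circ> w)"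
    if "\<not> ev_joined E (nbhd {x0} L) u w" "u \<in> end_seqs V E" "w \<in> end_seqs V E" for u w
  proof
    assume "ev_joined E D (\<phi> \<circ> u) (\<phi> \<circ> w)"
    then obtain N where N: "\<forall>m\<ge>N. \<forall>n\<ge>N. (\<phi> (u m), \<phi> (w n)) \<in> joined_off E D"
      unfolding ev_joined_def by auto
    have *: "v \<in> D" if "v \<in> V" "\<psi> v \<in> nbhd {x0} L" for v
      using \<phi>(2)[OF that(1)] that(2) unfolding D_def by force
    have "(\<psi> a, \<psi> b) \<in> joined_off E (nbhd {x0} L)" if "(a, b) \<in> joined_off E D" for a b
      by (rule joined_off_hom[OF that edges]) (use \<phi>(3) * in blast)+
    then have "\<forall>m\<ge>N. \<forall>n\<ge>N. (\<psi> (\<phi> (u m)), \<psi> (\<phi> (w n))) \<in> joined_off E (nbhd {x0} L)"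
      using N by blast
    then have "\<forall>m\<ge>N. \<forall>n\<ge>N. (u m, w n) \<in> joined_off E (nbhd {x0} L)"
      using \<phi>(2) end_seqs_in[OF that(2)] end_seqs_in[OF that(3)] by simp
    then show False using that(1) unfolding ev_joined_def by blast
  qed
  note seps = sep[OF L(1) ys(1,2)] sep[OF L(2) ys(1,3)] sep[OF L(3) ys(2,3)]
  note PER = ev_joined_sym[OF sym, of D] ev_joined_trans[of E D]
  \<comment> \<open>Pigeonhole with three candidates and two obstacles. As \<open>e\<close> is an
    arbitrary sequence, it need not be related to itself; symmetry and transitivity suffice.\<close>
  have "\<exists>z. z \<in> end_seqs V E \<and> \<not> ev_joined E D z e \<and> \<not> ev_joined E D z (\<lambda>_. x0)"
    using seps PER translate[OF ys(1)] translate[OF ys(2)] translate[OF ys(3)] by metis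
  then obtain z where z: "z \<in> end_seqs V E" "\<not> ev_joined E D z e" "\<not> ev_joined E D z (\<lambda>_. x0)"
    by blast
  \<comment> \<open>Radii must grow strictly so that the balls of the later recursion exhaust
    \<open>V\<close>.\<close>
  obtain M' where M': "Suc M \<le> M'" "D \<subseteq> nbhd {x0} M'"
    using finite_subset_nbhd[OF finD D_V x0] by blast
  obtain N1 where "\<forall>m\<ge>N1. z m \<notin> D" and N1: "\<forall>m\<ge>N1. \<forall>n\<ge>N1. (z m, z n) \<in> joined_off E D"
    by (rule end_seqs_obtain[OF z(1) finD finD])
  have "(z m, x) \<in> joined_off E ?K" if m: "m \<ge> N1" for m
  proof (rule joined_off_reach[where D = D])
    show "(z m, x) \<in> E\<^sup>*" using connected end_seqs_in[OF z(1)] x by blast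
    show "(z m, k) \<notin> joined_off E D" if k: "k \<in> ?K" for k
    proof
      assume "(z m, k) \<in> joined_off E D"
      then have "(z m, x0) \<in> joined_off E D"
        using K_x0[OF k] joined_off_sym[OF sym] joined_off_trans by metis
      then have "ev_joined E D z (\<lambda>_. x0)"
        unfolding ev_joined_def using N1 m joined_off_trans by metis
      then show False using z(3) by blast
    qed
  qed (use D_x in blast)
  then have "ev_joined E ?K z y"
    unfolding ev_joined_def using N(2)
    by (intro exI[of _ "max N N1"]) (auto simp: x_def intro: joined_off_trans[of _ "y N"])
  moreover have "\<not> ev_joined E (nbhd {x0} M') z e"
    using z(2) ev_joined_antimono[OF M'(2)] by blast
  ultimately show ?thesis using z(1) Suc_le_lessD[OF M'(1)] by blast
qed

text \<open>Each application of \<open>splitting_step\<close> excludes one \<open>e n\<close> while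
  staying in the current component. Since all later choices remain in that component,
  \<open>w\<close> inherits both its convergence and every exclusion.\<close>

lemma diverging_seq:
  fixes e :: "nat \<Rightarrow> nat \<Rightarrow> 'v"
  shows "\<exists>w \<in> end_seqs V E. \<forall>i. (w, e i) \<notin> seq_end_rel V E"
proof -
  define x0 where "x0 = y1 0"
  have x0: "x0 \<in> V" using end_seqs_in[OF ys(1)] by (simp add: x0_def)
  let ?B = "nbhd {x0}"
  \<comment> \<open>A stage is a radius paired with a sequence; passing from stage \<open>n\<close>
    to \<open>Suc n\<close> excludes \<open>e n\<close>.\<close>
  have "\<exists>f. \<forall>n. snd (f n) \<in> end_seqs V E \<and>
    (fst (f n) < fst (f (Suc n)) \<and> ev_joined E (?B (fst (f n))) (snd (f (Suc n))) (snd (f n)) \<and>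
      \<not> ev_joined E (?B (fst (f (Suc n)))) (snd (f (Suc n))) (e n))"
  proof (rule dependent_nat_choice)
    show "\<exists>x. snd x \<in> end_seqs V E" using ys(1) by force
    show "\<exists>b. snd b \<in> end_seqs V E \<and> fst a < fst b \<and>
        ev_joined E (?B (fst a)) (snd b) (snd a) \<and> \<not> ev_joined E (?B (fst b)) (snd b) (e n)"
      if "snd a \<in> end_seqs V E" for a :: "nat \<times> (nat \<Rightarrow> 'v)" and n
      using splitting_step[OF x0 that, of "fst a" "e n"] by force
  qed
  then obtain f where f: "\<And>n. snd (f n) \<in> end_seqs V E" "\<And>n. fst (f n) < fst (f (Suc n))"
    "\<And>n. ev_joined E (?B (fst (f n))) (snd (f (Suc n))) (snd (f n))"
    "\<And>n. \<not> ev_joined E (?B (fst (f (Suc n)))) (snd (f (Suc n))) (e n)"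
    by blast
  define K where "K n = ?B (fst (f n))" for n
  define y where "y n = snd (f n)" for n
  have finK: "finite (K n)" for n by (simp add: K_def finite_nbhd)
  have mono: "strict_mono (\<lambda>n. fst (f n))" using f(2) by (simp add: strict_mono_Suc_iff)
  have K_mono: "K m \<subseteq> K n" if "m \<le> n" for m n
    unfolding K_def using monoD[OF strict_mono_mono[OF mono] that] by (rule nbhd_mono)
  \<comment> \<open>The component of the complement of \<open>K n\<close> that contains the tail of
    \<open>y n\<close>.\<close>
  define C where "C n = {v \<in> V - K n. ev_joined E (K n) (\<lambda>_. v) (y n)}" for n
  have C_Suc: "C (Suc n) \<subseteq> C n" for n
  proof
    fix v assume v: "v \<in> C (Suc n)"
    then have "ev_joined E (K n) (\<lambda>_. v) (y (Suc n))"
      using ev_joined_antimono[OF K_mono[of n "Suc n"]] by (simp add: C_def)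
    then have "ev_joined E (K n) (\<lambda>_. v) (y n)"
      using f(3) ev_joined_trans unfolding K_def y_def by blast
    then show "v \<in> C n" using v K_mono[of n "Suc n"] by (auto simp: C_def)
  qed
  have C_mono: "C n \<subseteq> C m" if "m \<le> n" for m n
    using lift_Suc_antimono_le[of C, OF C_Suc that] .
  have "\<exists>v. v \<in> C n" for n
  proof -
    have yn: "y n \<in> end_seqs V E" using f(1) by (simp add: y_def)
    obtain N where N: "\<forall>m\<ge>N. y n m \<notin> K n"
      "\<forall>m\<ge>N. \<forall>k\<ge>N. (y n m, y n k) \<in> joined_off E (K n)"
      by (rule end_seqs_obtain[OF yn finK finK])
    have "y n N \<in> C n"
      unfolding C_def ev_joined_def using N end_seqs_in[OF yn] by auto
    then show ?thesis ..
  qed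
  then obtain w where w: "\<And>n. w n \<in> C n" by metis
  have w_C: "w n \<in> C m" if "m \<le> n" for m n using w C_mono[OF that] by blast
  have w_y: "ev_joined E (K m) w (y m)" for m
  proof -
    have *: "ev_joined E (K m) (\<lambda>_. w n) (y m)" if "n \<ge> m" for n
      using w_C[OF that] by (simp add: C_def)
    have ym: "y m \<in> end_seqs V E" using f(1) by (simp add: y_def)
    obtain N where "\<forall>k\<ge>N. y m k \<notin> K m" and N: "\<forall>k\<ge>N. \<forall>l\<ge>N. (y m k, y m l) \<in> joined_off E (K m)"
      by (rule end_seqs_obtain[OF ym finK finK])
    \<comment> \<open>The bound \<open>N'\<close> obtained below depends on \<open>n\<close>.
      Passing through a late term of \<open>y m\<close> replaces it by \<open>N\<close>, which is
      uniform in \<open>n\<close> as \<open>ev_joined\<close> requires.\<close>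
    have "(w n, y m k) \<in> joined_off E (K m)" if n: "n \<ge> m" and k: "k \<ge> N" for n k
    proof -
      obtain N' where N': "\<And>l. l \<ge> N' \<Longrightarrow> (w n, y m l) \<in> joined_off E (K m)"
        using *[OF n] unfolding ev_joined_def by blast
      show ?thesis
        using N'[of "max N N'"] N[rule_format, of "max N N'" k] k joined_off_trans by (metis max.cobounded1 max.cobounded2)
    qed
    then show ?thesis unfolding ev_joined_def by (intro exI[of _ "max m N"]) auto
  qed
  have exhaust: "\<exists>m. F \<inter> V \<subseteq> K m" if F: "finite F" for F
  proof -
    obtain n where "F \<inter> V \<subseteq> ?B n" by (rule exhaustion[OF F x0])
    \<comment> \<open>A strictly increasing sequence of natural numbers satisfies
      \<open>n \<le> fst (f n)\<close>.\<close>
    moreover have "?B n \<subseteq> K n" unfolding K_def using strict_mono_imp_increasing[OF mono] by (intro nbhd_mono)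
    ultimately show ?thesis by blast
  qed
  have w_V: "w n \<in> V" for n using w by (simp add: C_def)
  have "w \<in> end_seqs V E"
    unfolding end_seqs_def
  proof (intro CollectI conjI allI impI)
    show "range w \<subseteq> V" using w_V by blast
    fix F assume F: "finite (F :: 'v set)"
    obtain m where m: "F \<inter> V \<subseteq> K m" using exhaust[OF F] by blast
    have "ev_joined E (K m) w w"
      using w_y[of m] ev_joined_sym[OF sym] ev_joined_trans by blast
    then show "ev_joined E F w w" by (rule ev_joined_nbhd[OF m])
    have "w n \<notin> F" if "n \<ge> m" for n
      using w_C[OF that] m w_V by (auto simp: C_def)
    then show "\<forall>\<^sub>F n in sequentially. w n \<notin> F" unfolding eventually_sequentially by blast
  qed
  moreover have "(w, e i) \<notin> seq_end_rel V E" for i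
  proof
    assume "(w, e i) \<in> seq_end_rel V E"
    \<comment> \<open>The exclusion of \<open>e i\<close> is recorded at stage \<open>Suc i\<close>,
      hence the shifted ball.\<close>
    then have "ev_joined E (K (Suc i)) w (e i)" using finK unfolding seq_end_rel_def by blast
    then have "ev_joined E (K (Suc i)) (y (Suc i)) (e i)"
      using w_y[of "Suc i"] ev_joined_sym[OF sym] ev_joined_trans by blast
    then show False using f(4) by (simp add: K_def y_def)
  qed
  ultimately show ?thesis by blast
qed

end

lemma three_ends_imp_uncountable:
  assumes "a \<in> end_seqs V E // seq_end_rel V E" "b \<in> end_seqs V E // seq_end_rel V E"
    "c \<in> end_seqs V E // seq_end_rel V E" "a \<noteq> b" "a \<noteq> c" "b \<noteq> c"
  shows "uncountable (end_seqs V E // seq_end_rel V E)" (is "uncountable ?Q")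
proof
  assume count: "countable ?Q"
  note eq = equiv_seq_end_rel[OF sym, of V]
  obtain y1 y2 y3 where y: "y1 \<in> a" "y2 \<in> b" "y3 \<in> c"
    using assms(1-3)[THEN in_quotient_imp_non_empty[OF eq]] by auto
  have ys: "y1 \<in> end_seqs V E" "y2 \<in> end_seqs V E" "y3 \<in> end_seqs V E"
    using y assms(1-3)[THEN in_quotient_imp_subset[OF eq]] by auto
  have sep: "(y1, y2) \<notin> seq_end_rel V E" "(y1, y3) \<notin> seq_end_rel V E" "(y2, y3) \<notin> seq_end_rel V E"
    using quotient_eq_iff[OF eq assms(1,2) y(1,2)] quotient_eq_iff[OF eq assms(1,3) y(1,3)]
      quotient_eq_iff[OF eq assms(2,3) y(2,3)] assms(4-6) by simp_all
  \<comment> \<open>One representative of each class in an enumeration; \<open>from_nat_into\<close>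
    covers finite and infinite countable sets alike. The class of \<open>w\<close> would have to
    occur in it.\<close>
  define e where "e i = (SOME u. u \<in> from_nat_into ?Q i)" for i
  obtain w where w: "w \<in> end_seqs V E" "\<And>i. (w, e i) \<notin> seq_end_rel V E"
    using diverging_seq[OF ys sep, of e] by blast
  have "seq_end_rel V E `` {w} \<in> ?Q" using w(1) by (rule quotientI)
  then obtain i where i: "from_nat_into ?Q i = seq_end_rel V E `` {w}"
    using count from_nat_into_surj by metis
  have "w \<in> seq_end_rel V E `` {w}" using equiv_class_self[OF eq w(1)] .
  then have "e i \<in> seq_end_rel V E `` {w}" unfolding e_def i
    by (rule someI[where P = "\<lambda>u. u \<in> seq_end_rel V E `` {w}"])
  then show False using w(2) by blast
qed

lemma number_of_ends:
  "finite (end_seqs V E // seq_end_rel V E) \<and> card (end_seqs V E // seq_end_rel V E) \<in> {0, 1, 2} \<or>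
    uncountable (end_seqs V E // seq_end_rel V E)" (is "finite ?Q \<and> _ \<or> _")
proof (cases "finite ?Q \<and> card ?Q \<le> 2")
  case False
  then obtain T where "T \<subseteq> ?Q" "card T = 3"
    using infinite_arbitrarily_large[of ?Q 3] obtain_subset_with_card_n[of 3 ?Q] by fastforce
  then obtain a b c where "a \<in> ?Q" "b \<in> ?Q" "c \<in> ?Q" "a \<noteq> b" "a \<noteq> c" "b \<noteq> c"
    by (auto simp: card_3_iff)
  then show ?thesis using three_ends_imp_uncountable by blast
next
  case True
  then have "card ?Q \<in> {0, 1, 2}" unfolding insert_iff by linarith
  with True show ?thesis by blast
qed

end

section \<open>From convergent sequences to walks\<close>

text \<open>Using \<open>trancl\<close> gives every piece positive length, so the positions
  \<open>k i\<close> of the \<open>z i\<close> increase strictly. The index \<open>j\<close> in the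
  conclusion preserves which piece a step came from: after \<open>k i\<close> only pieces from the
  \<open>i\<close>-th on occur.\<close>

lemma concat_walks:
  fixes z :: "nat \<Rightarrow> 'v" and R :: "nat \<Rightarrow> 'v rel"
  assumes "\<And>i. (z i, z (Suc i)) \<in> (R i)\<^sup>+"
  obtains w k where "k 0 = 0" "strict_mono k" "\<forall>i. w (k i) = z i"
    "\<forall>i n. k i \<le> n \<longrightarrow> (\<exists>j\<ge>i. (w n, w (Suc n)) \<in> R j)"
proof -
  have "\<forall>i. \<exists>l f. 0 < l \<and> f 0 = z i \<and> f l = z (Suc i) \<and> (\<forall>j<l. (f j, f (Suc j)) \<in> R i)"
    using assms by (simp add: trancl_power relpow_fun_conv)
  then obtain l f where lf: "\<And>i. 0 < l i" "\<And>i. f i 0 = z i" "\<And>i. f i (l i) = z (Suc i)"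
    "\<And>i j. j < l i \<Longrightarrow> (f i j, f i (Suc j)) \<in> R i"
    by metis
  define k where "k i = sum l {..<i}" for i
  have k_Suc: "k (Suc i) = k i + l i" for i by (simp add: k_def)
  have k0: "k 0 = 0" by (simp add: k_def)
  have k: "strict_mono k" using lf(1) by (simp add: strict_mono_Suc_iff k_Suc)
  define block where "block n = (LEAST i. n < k (Suc i))" for n
  have block: "k (block n) \<le> n \<and> n < k (Suc (block n))" for n
  proof
    have "n < k (Suc n)" using strict_mono_imp_increasing[OF k, of "Suc n"] by simp
    then show "n < k (Suc (block n))" unfolding block_def by (rule LeastI)
    show "k (block n) \<le> n"
    proof (cases "block n")
      case (Suc j)
      then have "\<not> n < k (Suc j)" using not_less_Least[of j "\<lambda>i. n < k (Suc i)"] by (simp add: block_def)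
      with Suc show ?thesis by simp
    qed (simp add: k_def)
  qed
  have block_eq: "block n = i" if "k i \<le> n" "n < k (Suc i)" for n i
  proof (rule antisym)
    show "block n \<le> i" unfolding block_def using that(2) by (rule Least_le)
    show "i \<le> block n"
    proof (rule ccontr)
      assume "\<not> i \<le> block n"
      then have "k (Suc (block n)) \<le> k i" by (intro monoD[OF strict_mono_mono[OF k]]) simp
      then show False using block[of n] that(1) by linarith
    qed
  qed
  define w where "w n = f (block n) (n - k (block n))" for n
  have w: "w (k i) = z i" for i
    using block_eq[of i "k i"] lf(1)[of i] by (simp add: w_def k_Suc lf(2))
  have step: "(w n, w (Suc n)) \<in> R (block n)" for n
  proof -
    let ?i = "block n"
    have n: "k ?i \<le> n" "n < k ?i + l ?i" using block[of n] by (auto simp: k_Suc)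
    have "w (Suc n) = f ?i (Suc (n - k ?i))"
    proof (cases "Suc n < k (Suc ?i)")
      case True
      then have "block (Suc n) = ?i" using block_eq[of ?i "Suc n"] n by simp
      then show ?thesis using n by (simp add: w_def Suc_diff_le)
    next
      \<comment> \<open>The last step of a piece: \<open>w\<close> switches to the next piece, whose
        start is the end of the present one.\<close>
      case False
      then have "Suc n = k (Suc ?i)" "Suc (n - k ?i) = l ?i" using n by (auto simp: k_Suc)
      then show ?thesis using w[of "Suc ?i"] lf(3)[of ?i] by simp
    qed
    moreover have "n - k ?i < l ?i" using n by linarith
    ultimately show ?thesis using lf(4)[of "n - k ?i" ?i] by (simp add: w_def)
  qed
  have "\<exists>j\<ge>i. (w n, w (Suc n)) \<in> R j" if "k i \<le> n" for i n
  proof -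
    have "k i < k (Suc (block n))" using that block[of n] by linarith
    then have "i \<le> block n" using strict_mono_less[OF k] by simp
    then show ?thesis using step by blast
  qed
  then show thesis using that[OF k0 k] w by blast
qed

context lf_graph
begin

text \<open>A sparse subsequence of \<open>y\<close> is joined by paths whose \<open>i\<close>-th
  piece avoids the ball of radius \<open>i\<close>; the resulting walk leaves every ball and stays
  joined to \<open>y\<close>.\<close>

lemma walk_to_end:
  assumes y: "y \<in> end_seqs V E"
  obtains w where "(w, y) \<in> seq_end_rel V E" "\<forall>n. (w n, w (Suc n)) \<in> E"
proof -
  define x0 where "x0 = y 0"
  have x0: "x0 \<in> V" using end_seqs_in[OF y] by (simp add: x0_def)
  let ?B = "nbhd {x0}"
  have finB: "finite (?B i)" for i by (simp add: finite_nbhd)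
  \<comment> \<open>Consecutive chosen terms are made distinct so that the connecting paths are
    nonempty.\<close>
  have "\<exists>N. \<forall>i. (\<forall>m\<ge>N i. y m \<notin> ?B i \<and> (\<forall>n\<ge>N i. (y m, y n) \<in> joined_off E (?B i))) \<and>
      N i < N (Suc i) \<and> y (N (Suc i)) \<noteq> y (N i)"
  proof (rule dependent_nat_choice)
    show "\<exists>N. \<forall>m\<ge>N. y m \<notin> ?B 0 \<and> (\<forall>n\<ge>N. (y m, y n) \<in> joined_off E (?B 0))"
      using end_seqs_obtain[OF y finB finB] by metis
    show "\<exists>N'. (\<forall>m\<ge>N'. y m \<notin> ?B (Suc i) \<and> (\<forall>n\<ge>N'. (y m, y n) \<in> joined_off E (?B (Suc i)))) \<and>
        N < N' \<and> y N' \<noteq> y N" for N i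
    proof -
      obtain M where "\<forall>m\<ge>M. y m \<notin> insert (y N) (?B (Suc i))"
        "\<forall>m\<ge>M. \<forall>n\<ge>M. (y m, y n) \<in> joined_off E (?B (Suc i))"
        by (rule end_seqs_obtain[OF y finB[of "Suc i"] finite.insertI[OF finB[of "Suc i"], of "y N"]])
      then show ?thesis by (intro exI[of _ "max M (Suc N)"]) auto
    qed
  qed
  then obtain N where N: "\<And>i m. m \<ge> N i \<Longrightarrow> y m \<notin> ?B i"
    "\<And>i m n. m \<ge> N i \<Longrightarrow> n \<ge> N i \<Longrightarrow> (y m, y n) \<in> joined_off E (?B i)"
    "\<And>i. N i < N (Suc i)" "\<And>i. y (N (Suc i)) \<noteq> y (N i)"
    by blast
  define R where "R i = E \<inter> (- ?B i) \<times> (- ?B i)" for i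
  have R_mono: "R j \<subseteq> R i" if "i \<le> j" for i j
    unfolding R_def using nbhd_mono[OF that, of "{x0}"] by blast
  have "(y (N i), y (N (Suc i))) \<in> (R i)\<^sup>+" for i
  proof -
    have "(y (N i), y (N (Suc i))) \<in> (R i)\<^sup>*"
      using N(2)[of i "N i" "N (Suc i)"] N(3)[of i] by (simp add: R_def joined_off_def)
    then show ?thesis using N(4)[of i] by (simp add: rtrancl_eq_or_trancl)
  qed
  then obtain w k where k: "k 0 = 0" "strict_mono k" and w: "\<forall>i. w (k i) = y (N i)"
    "\<forall>i n. k i \<le> n \<longrightarrow> (\<exists>j\<ge>i. (w n, w (Suc n)) \<in> R j)"
    by (rule concat_walks[of "\<lambda>i. y (N i)" R]) blast
  have step: "(w n, w (Suc n)) \<in> R i" if "k i \<le> n" for i n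
    using w(2) that R_mono by blast
  have walk: "(w n, w (Suc n)) \<in> E" for n
    using step[of 0 n] k(1) by (simp add: R_def)
  then have w_V: "w n \<in> V" for n using edges by blast
  have joined: "(y (N i), w m) \<in> joined_off E (?B i)" if "k i \<le> m" for i m
    using that
  proof (induction m rule: dec_induct)
    case (step m)
    then show ?case
      using \<open>\<And>i n. k i \<le> n \<Longrightarrow> (w n, w (Suc n)) \<in> R i\<close>[of i m]
      by (auto simp: R_def intro: joined_off_trans joined_off_edge)
  qed (simp add: w)
  have wy: "ev_joined E (?B i) w y" for i
    unfolding ev_joined_def
  proof (intro exI[of _ "max (k i) (N i)"] allI impI)
    fix m n assume "max (k i) (N i) \<le> m" "max (k i) (N i) \<le> n"
    then show "(w m, y n) \<in> joined_off E (?B i)"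
      using joined_off_trans[OF joined_off_sym[OF sym joined[of i m]] N(2)[of i "N i" n]] by simp
  qed
  have wy': "ev_joined E F w y" if "finite F" for F
    using ev_joined_nbhd wy exhaustion[OF that x0] by metis
  have "w \<in> end_seqs V E"
    unfolding end_seqs_def
  proof (intro CollectI conjI allI impI)
    show "range w \<subseteq> V" using w_V by blast
    fix F assume F: "finite (F :: 'v set)"
    show "ev_joined E F w w"
      using wy'[OF F] ev_joined_sym[OF sym] ev_joined_trans by blast
    obtain i where i: "F \<inter> V \<subseteq> ?B i" by (rule exhaustion[OF F x0])
    have "w n \<notin> F" if "k i \<le> n" for n
      using step[OF that] i w_V by (auto simp: R_def)
    then show "\<forall>\<^sub>F n in sequentially. w n \<notin> F" unfolding eventually_sequentially by blast
  qed
  then have "(w, y) \<in> seq_end_rel V E" using y wy' by (simp add: seq_end_rel_def)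
  then show thesis using that walk by blast
qed

end

section \<open>Comparing adjacency relations and quotients\<close>

text \<open>To test a finite \<open>F\<close> for \<open>E\<close>, test its
  \<open>L\<close>-neighbourhood for \<open>E'\<close>; local finiteness keeps that neighbourhood
  finite.\<close>

lemma (in lf_graph) ends_coarser:
  assumes E': "\<And>x y. (x, y) \<in> E' \<Longrightarrow> y \<in> nbhd {x} L"
  shows "end_seqs V E' \<subseteq> end_seqs V E" and "seq_end_rel V E' \<subseteq> seq_end_rel V E"
proof -
  have coarser: "ev_joined E F y z" if "ev_joined E' (nbhd F L) y z" for F y z
    by (rule ev_joined_coarser[OF joined_off_far that]) (rule E')
  show *: "end_seqs V E' \<subseteq> end_seqs V E"
    using coarser finite_nbhd unfolding end_seqs_def by blast
  show "seq_end_rel V E' \<subseteq> seq_end_rel V E"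
    using coarser finite_nbhd * unfolding seq_end_rel_def by blast
qed

text \<open>Since \<open>R\<close> is the pullback of \<open>R'\<close> along \<open>f\<close>, the
  induced map on classes is well defined and injective; \<open>surj\<close> makes it onto.\<close>

lemma quotient_eqpoll:
  assumes R: "R = {(x, y). x \<in> A \<and> y \<in> A \<and> (f x, f y) \<in> R'}" and eq: "equiv B R'"
    and f: "f ` A \<subseteq> B" and surj: "\<And>b. b \<in> B \<Longrightarrow> \<exists>a\<in>A. (f a, b) \<in> R'"
  shows "A // R \<approx> B // R'"
proof -
  have cls: "R' `` (f ` (R `` {x})) = R' `` {f x}" if x: "x \<in> A" for x
  proof
    show "R' `` (f ` (R `` {x})) \<subseteq> R' `` {f x}"
      using eq unfolding R equiv_def trans_def by blast
    have "x \<in> R `` {x}" using x f equiv_class_self[OF eq, of "f x"] by (auto simp: R)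
    then show "R' `` {f x} \<subseteq> R' `` (f ` (R `` {x}))" by blast
  qed
  have "bij_betw (\<lambda>c. R' `` (f ` c)) (A // R) (B // R')"
    unfolding bij_betw_def
  proof
    show "inj_on (\<lambda>c. R' `` (f ` c)) (A // R)"
    proof (rule inj_onI, elim quotientE, simp add: cls)
      fix x y assume xy: "x \<in> A" "y \<in> A" and "R' `` {f x} = R' `` {f y}"
      then have "(f x, f y) \<in> R'" using eq_equiv_class[OF _ eq] f by blast
      then have "(f x, u) \<in> R' \<longleftrightarrow> (f y, u) \<in> R'" for u
        using eq unfolding equiv_def trans_def sym_def by blast
      then show "R `` {x} = R `` {y}" using xy by (auto simp: R)
    qed
    show "(\<lambda>c. R' `` (f ` c)) ` (A // R) = B // R'"
    proof
      show "(\<lambda>c. R' `` (f ` c)) ` (A // R) \<subseteq> B // R'"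
        using f by (auto elim!: quotientE simp: cls intro!: quotientI)
      show "B // R' \<subseteq> (\<lambda>c. R' `` (f ` c)) ` (A // R)"
      proof
        fix c assume "c \<in> B // R'"
        then obtain b where b: "b \<in> B" "c = R' `` {b}" by (rule quotientE)
        obtain a where a: "a \<in> A" "(f a, b) \<in> R'" using surj[OF b(1)] by blast
        have "c = R' `` (f ` (R `` {a}))"
          using cls[OF a(1)] equiv_class_eq[OF eq a(2)] b(2) by simp
        then show "c \<in> (\<lambda>c. R' `` (f ` c)) ` (A // R)" using quotientI[OF a(1)] by blast
      qed
    qed
  qed
  then show ?thesis unfolding eqpoll_def by blast
qed

section \<open>Ends in terms of vertex sequences\<close>

text \<open>Labels, multiplicities and directions are forgotten, loops are kept. Going through the
  oriented graph makes each step of an edge path a pair in this relation.\<close>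

definition adj :: "('v, 'e) pre_digraph \<Rightarrow> 'v rel" where
  "adj X = (\<lambda>d. (tail (oriented_graph X) d, head (oriented_graph X) d)) ` arcs (oriented_graph X)"

definition ray_verts :: "('v, 'e) pre_digraph \<Rightarrow> (nat \<Rightarrow> 'e \<times> bool) \<Rightarrow> nat \<Rightarrow> 'v" where
  "ray_verts X r n = tail (oriented_graph X) (r n)"

lemma adj_eq:
  fixes X :: "('v, 'e) pre_digraph"
  defines "P \<equiv> (\<lambda>e. (tail X e, head X e)) ` arcs X"
  shows "adj X = P \<union> P\<inverse>"
proof -
  have "arcs X \<times> (UNIV :: bool set) = (\<lambda>e. (e, True)) ` arcs X \<union> (\<lambda>e. (e, False)) ` arcs X"
    by (auto simp: image_iff)
  then have "adj X = P \<union> (\<lambda>e. (head X e, tail X e)) ` arcs X"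
    by (simp add: adj_def oriented_graph_def P_def image_Un image_image)
  also have "(\<lambda>e. (head X e, tail X e)) ` arcs X = P\<inverse>" by (auto simp: P_def)
  finally show ?thesis .
qed

lemma oriented_edge_map_ends [simp]:
  "oriented_edge_map X d 0 = Vertex (tail (oriented_graph X) d)"
  "oriented_edge_map X d 1 = Vertex (head (oriented_graph X) d)"
  by (cases d; simp add: oriented_graph_def edge_map_def)+

section \<open>Compact subsets of the realization\<close>

lemma edge_map_fibre: "finite {t. edge_map X e t = q}"
proof (rule finite_subset)
  show "{t. edge_map X e t = q} \<subseteq> {0, 1} \<union> (case q of Inner e' s \<Rightarrow> {s} | _ \<Rightarrow> {})"
    by (auto simp: edge_map_def split: if_splits)
  show "finite ({0, 1} \<union> (case q of Inner e' s \<Rightarrow> {s} | _ \<Rightarrow> {}))"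
    by (cases q) auto
qed

context wf_digraph
begin

lemma edge_map_in: "e \<in> arcs G \<Longrightarrow> 0 \<le> t \<Longrightarrow> t \<le> 1 \<Longrightarrow> edge_map G e t \<in> graph_points G"
  by (auto simp: edge_map_def graph_points_def)

lemma openin_realization_Diff:
  assumes "\<And>e. e \<in> arcs G \<Longrightarrow> closed {t \<in> {0..1}. edge_map G e t \<in> D}"
  shows "openin (realization G) (graph_points G - D)"
  unfolding openin_realization
proof (intro conjI ballI)
  fix e assume e: "e \<in> arcs G"
  have "{t \<in> {0..1}. edge_map G e t \<in> graph_points G - D} = {0..1} - {t \<in> {0..1}. edge_map G e t \<in> D}"
    using edge_map_in[OF e] by auto
  moreover have "openin (top_of_set {0..1}) ({0..1} - {t \<in> {0..1}. edge_map G e t \<in> D})"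
    by (intro openin_diff openin_subtopology_self closed_subset assms e) auto
  ultimately show "openin (top_of_set {0..1}) {t \<in> {0..1}. edge_map G e t \<in> graph_points G - D}"
    by (simp only:)
qed blast

lemma topspace_realization: "topspace (realization G) = graph_points G"
proof
  show "topspace (realization G) \<subseteq> graph_points G"
    using openin_realization[of G "topspace (realization G)"] by simp
  show "graph_points G \<subseteq> topspace (realization G)"
    using openin_realization_Diff[of "{}"] by (simp add: openin_subset)
qed

text \<open>A set meeting every open edge in finitely many points is closed, and so are all its
  subsets: it is discrete.\<close>

lemma compactin_discrete_finite:
  assumes C: "compactin (realization G) C" and D: "D \<subseteq> C" "\<And>e. finite {t. Inner e t \<in> D}"
  shows "finite D"
proof -
  have CG: "C \<subseteq> graph_points G" using C topspace_realization by (simp add: compactin_def)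
  have op: "openin (realization G) (graph_points G - D')" if "D' \<subseteq> D" for D'
  proof (rule openin_realization_Diff, rule finite_imp_closed)
    fix e
    have "{t \<in> {0..1}. edge_map G e t \<in> D'} \<subseteq> {0, 1} \<union> {t. Inner e t \<in> D}"
      using that by (auto simp: edge_map_def)
    then show "finite {t \<in> {0..1}. edge_map G e t \<in> D'}"
      using D(2) finite_subset by blast
  qed
  let ?U = "\<lambda>d. graph_points G - (D - {d})"
  \<comment> \<open>Every subset of \<open>D\<close> has an open complement. In this cover only
    \<open>?U d\<close> contains the point \<open>d\<close> of \<open>D\<close>, so a finite
    subcover must include all of the \<open>?U d\<close>.\<close>
  have "\<exists>\<F>. finite \<F> \<and> \<F> \<subseteq> insert (graph_points G - D) (?U ` D) \<and> C \<subseteq> \<Union>\<F>"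
    using CG by (intro compactinD[OF C]) (auto intro: op)
  then obtain \<F> where \<F>: "finite \<F>" "\<F> \<subseteq> insert (graph_points G - D) (?U ` D)" "C \<subseteq> \<Union>\<F>"
    by blast
  have "?U d \<in> \<F>" if d: "d \<in> D" for d
  proof -
    obtain W where "W \<in> \<F>" "d \<in> W" using d D(1) \<F>(3) by blast
    then show ?thesis using \<F>(2) d by auto
  qed
  moreover have "inj_on ?U D"
    using D(1) CG by (auto simp: inj_on_def)
  ultimately show ?thesis
    using \<F>(1) by (meson finite_imageD finite_subset image_subsetI)
qed

text \<open>The finite vertex set that replaces a compact set: an edge with both ends outside it
  misses \<open>C\<close> altogether.\<close>

definition touched :: "('a, 'b) graph_point set \<Rightarrow> 'a set" where
  "touched C = {v. Vertex v \<in> C} \<union> (\<Union>e\<in>{e. \<exists>t. Inner e t \<in> C}. {tail G e, head G e})"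

text \<open>The vertices in \<open>C\<close>, and one chosen interior point for each open edge
  meeting \<open>C\<close>, are discrete subsets of \<open>C\<close>.\<close>

lemma finite_touched:
  assumes C: "compactin (realization G) C"
  shows "finite (touched C)"
proof -
  have "finite (Vertex ` {v. Vertex v \<in> C} :: ('a, 'b) graph_point set)"
    by (rule compactin_discrete_finite[OF C]) (auto simp: image_iff)
  then have "finite {v. Vertex v \<in> C}" by (rule finite_imageD) (simp add: inj_on_def)
  moreover have "finite {e. \<exists>t. Inner e t \<in> C}"
  proof -
    let ?f = "\<lambda>e. Inner e (SOME t. Inner e t \<in> C) :: ('a, 'b) graph_point"
    have "finite (?f ` {e. \<exists>t. Inner e t \<in> C})"
    proof (rule compactin_discrete_finite[OF C])
      show "?f ` {e. \<exists>t. Inner e t \<in> C} \<subseteq> C" by (auto intro: someI)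
      show "finite {t. Inner e t \<in> ?f ` {e. \<exists>t. Inner e t \<in> C}}" for e
        by (rule finite_subset[of _ "{SOME t. Inner e t \<in> C}"]) auto
    qed
    then show ?thesis by (rule finite_imageD) (simp add: inj_on_def)
  qed
  ultimately show ?thesis by (simp add: touched_def)
qed

lemma oriented_edge_avoids:
  assumes "d \<in> arcs (oriented_graph G)" "tail (oriented_graph G) d \<notin> touched C"
    "head (oriented_graph G) d \<notin> touched C"
  shows "oriented_edge_map G d t \<notin> C"
proof -
  obtain e b where d: "d = (e, b)" by (cases d)
  have te: "tail G e \<notin> touched C" "head G e \<notin> touched C"
    using assms by (auto simp: d oriented_graph_def split: if_splits)
  then have "edge_map G e s \<notin> C" for s
    by (auto simp: touched_def edge_map_def)
  then show ?thesis by (simp add: d)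
qed

text \<open>Plays the part of closedness of compact sets in a Hausdorff space. Around a parameter
  \<open>t0\<close> outside the preimage, the complements of the images of shrinking closed
  intervals form an increasing open cover of \<open>C\<close>, so one of them contains
  \<open>C\<close>.\<close>

lemma closed_edge_map_preimage:
  assumes C: "compactin (realization G) C" and e: "e \<in> arcs G"
  shows "closed {t \<in> {0..1}. edge_map G e t \<in> C}"
proof -
  have CG: "C \<subseteq> graph_points G" using C topspace_realization by (simp add: compactin_def)
  have "\<exists>\<delta>>0. \<forall>t\<in>{0..1}. dist t t0 < \<delta> \<longrightarrow> edge_map G e t \<notin> C"
    if t0: "t0 \<in> {0..1}" "edge_map G e t0 \<notin> C" for t0
  proof -
    define I where "I n = {0..1} \<inter> cball t0 (inverse (real (Suc n)))" for n
    define U where "U n = graph_points G - edge_map G e ` I n" for n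
    have op: "openin (realization G) (U n)" for n
      unfolding U_def
    proof (rule openin_realization_Diff)
      fix e' assume "e' \<in> arcs G"
      let ?J = "{t \<in> {0..1}. edge_map G e' t \<in> edge_map G e ` I n}"
      have I: "closed (I n)" "I n \<subseteq> {0..1}" unfolding I_def by auto
      \<comment> \<open>Distinct edges share at most end vertices, and these correspond to the
        parameters 0 and 1.\<close>
      have "?J = (if e' = e then I n else {}) \<union> (?J \<inter> {0, 1})"
        using I(2) by (auto simp: edge_map_def split: if_splits)
      moreover have "closed ((if e' = e then I n else {}) \<union> (?J \<inter> {0, 1}))"
        using I(1) by (intro closed_Un) (auto intro: finite_imp_closed)
      ultimately show "closed ?J" by (simp only:)
    qed
    have U_mono: "U m \<subseteq> U n" if "m \<le> n" for m n
    proof -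
      have "inverse (real (Suc n)) \<le> inverse (real (Suc m))" using that by simp
      then have "I n \<subseteq> I m" unfolding I_def by (auto simp: subset_iff intro: order_trans)
      then show ?thesis unfolding U_def by blast
    qed
    have "C \<subseteq> (\<Union>n. U n)"
    proof
      fix q assume q: "q \<in> C"
      let ?S = "{t. edge_map G e t = q}"
      \<comment> \<open>A point of \<open>C\<close> has finitely many parameters on the edge, none
        equal to \<open>t0\<close>, so a small interval around \<open>t0\<close> avoids
        them.\<close>
      have "open (- ?S)" by (intro open_Compl finite_imp_closed edge_map_fibre)
      moreover have "t0 \<in> - ?S" using t0(2) q by auto
      ultimately obtain \<delta> where \<delta>: "\<delta> > 0" "cball t0 \<delta> \<subseteq> - ?S"
        using open_contains_cball by blast
      obtain n where "inverse (real (Suc n)) < \<delta>" using reals_Archimedean[OF \<delta>(1)] by blast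
      then have "I n \<subseteq> - ?S" using \<delta>(2) by (auto simp: I_def subset_iff)
      then have "q \<in> U n" using q CG by (auto simp: U_def)
      then show "q \<in> (\<Union>n. U n)" by blast
    qed
    then have "\<exists>\<F>. finite \<F> \<and> \<F> \<subseteq> range U \<and> C \<subseteq> \<Union>\<F>"
      by (intro compactinD[OF C]) (auto intro: op)
    then obtain K where K: "finite K" "C \<subseteq> (\<Union>n\<in>K. U n)"
      by (metis finite_subset_image)
    then obtain m where m: "\<forall>n\<in>K. n \<le> m" using finite_nat_set_iff_bounded_le by blast
    have "C \<subseteq> U m" using K(2) m U_mono by blast
    then have "edge_map G e t \<notin> C" if "t \<in> {0..1}" "dist t t0 < inverse (real (Suc m))" for t
      using that by (auto simp: U_def I_def dist_commute)
    then show ?thesis by (intro exI[of _ "inverse (real (Suc m))"]) auto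
  qed
  then have *: "closedin (top_of_set {0..1}) ({0..1} - {t \<in> {0..1}. edge_map G e t \<notin> C})"
    by (intro closedin_diff) (auto simp: openin_euclidean_subtopology_iff)
  have "{0..1} - {t \<in> {0..1}. edge_map G e t \<notin> C} = {t \<in> {0..1}. edge_map G e t \<in> C}" by blast
  then show ?thesis using * closedin_closed_trans[of "{0..1::real}"] by simp
qed

lemma compact_oriented_edge_map_preimage:
  assumes C: "compactin (realization G) C" and d: "d \<in> arcs (oriented_graph G)"
  shows "compact {t \<in> {0..1}. oriented_edge_map G d t \<in> C}"
proof -
  obtain e b where d': "d = (e, b)" by (cases d)
  then have "e \<in> arcs G" using d by (simp add: oriented_graph_def)
  then have "closed {t \<in> {0..1}. edge_map G e t \<in> C}" by (rule closed_edge_map_preimage[OF C])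
  then have comp: "compact {t \<in> {0..1}. edge_map G e t \<in> C}"
    by (auto simp: compact_eq_bounded_closed intro: bounded_subset[of "{0..1}"])
  show ?thesis
  proof (cases b)
    case True
    then show ?thesis using comp by (simp add: d')
  next
    case False
    have "{t \<in> {0..1}. oriented_edge_map G d t \<in> C} = (\<lambda>t. 1 - t) ` {t \<in> {0..1}. edge_map G e t \<in> C}"
    proof
      show "{t \<in> {0..1}. oriented_edge_map G d t \<in> C} \<subseteq> (\<lambda>t. 1 - t) ` {t \<in> {0..1}. edge_map G e t \<in> C}"
      proof
        fix t assume "t \<in> {t \<in> {0..1}. oriented_edge_map G d t \<in> C}"
        then show "t \<in> (\<lambda>t. 1 - t) ` {t \<in> {0..1}. edge_map G e t \<in> C}"
          using False by (intro image_eqI[of _ _ "1 - t"]) (auto simp: d')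
      qed
    qed (use False in \<open>auto simp: d'\<close>)
    then show ?thesis
      using comp by (simp add: compact_continuous_image continuous_intros)
  qed
qed

section \<open>Rays and their equivalence in terms of vertices\<close>

lemma oriented_ends_in:
  "d \<in> arcs (oriented_graph G) \<Longrightarrow> tail (oriented_graph G) d \<in> verts G \<and> head (oriented_graph G) d \<in> verts G"
  by (cases d) (auto simp: oriented_graph_def)

text \<open>A vertex is compact, so a proper ray visits it during a bounded time. Conversely,
  finitely many visits to \<open>touched C\<close> confine the time spent in \<open>C\<close> to
  finitely many edges, each contributing a compact set.\<close>

lemma proper_rays_iff:
  "r \<in> proper_rays G \<longleftrightarrow>
     infinite_edge_path G r \<and> (\<forall>v. finite {n. ray_verts G r n = v})" (is "_ \<longleftrightarrow> ?R")
proof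
  assume r: "r \<in> proper_rays G"
  have "finite {n. ray_verts G r n = v}" for v
  proof (cases "v \<in> verts G")
    case True
    then have "compactin (realization G) {Vertex v}"
      by (intro finite_imp_compactin) (auto simp: topspace_realization graph_points_def)
    then have "compact {t. 0 \<le> t \<and> ray_map G r t \<in> {Vertex v}}"
      using r unfolding proper_rays_def by blast
    then obtain B where B: "\<forall>t\<in>{t. 0 \<le> t \<and> ray_map G r t \<in> {Vertex v}}. norm t \<le> B"
      using compact_imp_bounded bounded_iff by metis
    have "{n. ray_verts G r n = v} \<subseteq> {..nat \<lfloor>B\<rfloor>}"
    proof
      fix n assume "n \<in> {n. ray_verts G r n = v}"
      then have "real n \<le> B" using B ray_map_of_nat[of G r n] by (auto simp: ray_verts_def)
      then show "n \<in> {..nat \<lfloor>B\<rfloor>}" by (simp add: le_nat_floor)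
    qed
    then show ?thesis using finite_subset by blast
  next
    case False
    then have "{n. ray_verts G r n = v} = {}"
      using r oriented_ends_in unfolding proper_rays_def infinite_edge_path_def ray_verts_def by blast
    then show ?thesis by simp
  qed
  then show ?R using r by (simp add: proper_rays_def)
next
  assume R: ?R
  then have arc: "r n \<in> arcs (oriented_graph G)"
    and link: "head (oriented_graph G) (r n) = ray_verts G r (Suc n)" for n
    by (auto simp: infinite_edge_path_def ray_verts_def)
  have "compact {t. 0 \<le> t \<and> ray_map G r t \<in> C}" if C: "compactin (realization G) C" for C
  proof -
    have "finite (\<Union>v\<in>touched C. {n. ray_verts G r n = v})"
      using R finite_touched[OF C] by blast
    then obtain N where N: "(\<Union>v\<in>touched C. {n. ray_verts G r n = v}) \<subseteq> {..<N}"
      using finite_nat_iff_bounded by blast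
    have avoid: "oriented_edge_map G (r n) t \<notin> C" if "n \<ge> N" for n t
    proof (rule oriented_edge_avoids[OF arc])
      have "ray_verts G r m \<notin> touched C" if "m \<ge> N" for m
        using N that by (auto simp: subset_iff dest: leD)
      then show "tail (oriented_graph G) (r n) \<notin> touched C" "head (oriented_graph G) (r n) \<notin> touched C"
        using that link[of n] by (auto simp: ray_verts_def)
    qed
    \<comment> \<open>At \<open>s = 1\<close> the floor already selects edge \<open>n + 1\<close>;
      the formula survives because edge \<open>n\<close> ends where edge \<open>n + 1\<close>
      starts.\<close>
    have ray_map_add: "ray_map G r (s + real n) = oriented_edge_map G (r n) s"
      if "s \<in> {0..1}" for n s
    proof (cases "s = 1")
      case True
      then have "ray_map G r (s + real n) = ray_map G r (real (Suc n))" by (simp add: add.commute)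
      also have "\<dots> = oriented_edge_map G (r n) 1"
        unfolding ray_map_of_nat using link[of n] by (simp add: ray_verts_def)
      finally show ?thesis using True by simp
    next
      case False
      then have "\<lfloor>s + real n\<rfloor> = int n" using that by (intro floor_unique) auto
      then show ?thesis by (simp add: ray_map_def frac_def)
    qed
    have "{t. 0 \<le> t \<and> ray_map G r t \<in> C} =
        (\<Union>n<N. (\<lambda>s. s + real n) ` {s \<in> {0..1}. oriented_edge_map G (r n) s \<in> C})" (is "?T = ?U")
    proof
      show "?T \<subseteq> ?U"
      proof
        fix t assume t: "t \<in> ?T"
        define n where "n = nat \<lfloor>t\<rfloor>"
        have s: "t = frac t + real n" "frac t \<in> {0..1}"
          using t frac_lt_1[of t] by (auto simp: n_def frac_def)
        have "oriented_edge_map G (r n) (frac t) \<in> C"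
          using t ray_map_add[OF s(2), of n] s(1) by simp
        moreover from this have "n < N" using avoid[of n] by (meson not_le)
        ultimately show "t \<in> ?U" using s by blast
      qed
      show "?U \<subseteq> ?T" by (auto simp: ray_map_add)
    qed
    also have "compact \<dots>"
      by (intro compact_UN compact_continuous_image compact_oriented_edge_map_preimage C arc
          continuous_intros finite_lessThan)
    finally show ?thesis .
  qed
  then show "r \<in> proper_rays G" using R by (simp add: proper_rays_def)
qed

lemma edge_path_joined_off:
  assumes "edge_path G u p v" "edge_path_image G u p \<inter> Vertex ` F = {}"
  shows "(u, v) \<in> joined_off (adj G) F"
  using assms
proof (induction p arbitrary: u)
  case Nil
  then show ?case by (simp add: edge_path_def pre_digraph.awalk_def pre_digraph.cas.simps)
next
  case (Cons d p)
  let ?h = "head (oriented_graph G) d"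
  have d: "d \<in> arcs (oriented_graph G)" "tail (oriented_graph G) d = u" and p: "edge_path G ?h p v"
    using Cons.prems(1) oriented_ends_in[of d]
    by (auto simp: edge_path_def pre_digraph.awalk_def pre_digraph.cas.simps oriented_graph_def)
  have h: "Vertex ?h \<in> oriented_edge_map G d ` {0..1}"
    by (rule image_eqI[of _ _ 1]) auto
  have "u \<notin> F" using Cons.prems(2) by (auto simp: edge_path_image_def)
  moreover have "?h \<notin> F"
    using Cons.prems(2) h unfolding edge_path_image_def list.set UN_insert by blast
  moreover have "(u, ?h) \<in> adj G" using d by (force simp: adj_def)
  ultimately have "(u, ?h) \<in> joined_off (adj G) F" by (intro joined_off_edge)
  moreover have "(?h, v) \<in> joined_off (adj G) F"
  proof (rule Cons.IH[OF p])
    have "edge_path_image G ?h p \<subseteq> edge_path_image G u (d # p)"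
      unfolding edge_path_image_def list.set UN_insert using h by blast
    then show "edge_path_image G ?h p \<inter> Vertex ` F = {}" using Cons.prems(2) by blast
  qed
  ultimately show ?case by (rule joined_off_trans)
qed

lemma joined_off_edge_path:
  assumes "(u, v) \<in> joined_off (adj G) F" "u \<in> verts G"
  obtains p where "edge_path G u p v"
    "\<And>d. d \<in> set p \<Longrightarrow> tail (oriented_graph G) d \<notin> F \<and> head (oriented_graph G) d \<notin> F"
proof -
  have "\<exists>p. edge_path G u p v \<and>
      (\<forall>d\<in>set p. tail (oriented_graph G) d \<notin> F \<and> head (oriented_graph G) d \<notin> F)"
    using assms unfolding joined_off_def
  proof (induction rule: converse_rtrancl_induct)
    case base
    then show ?case
      by (intro exI[of _ "[]"]) (simp add: edge_path_def pre_digraph.awalk_def pre_digraph.cas.simps oriented_graph_def)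
  next
    case (step u u')
    then obtain d where d: "d \<in> arcs (oriented_graph G)" "tail (oriented_graph G) d = u"
      "head (oriented_graph G) d = u'"
      by (auto simp: adj_def)
    then obtain p where "edge_path G u' p v"
      "\<forall>d\<in>set p. tail (oriented_graph G) d \<notin> F \<and> head (oriented_graph G) d \<notin> F"
      using step.IH oriented_ends_in by blast
    then show ?case
      using d step.hyps(1) step.prems
      by (intro exI[of _ "d # p"])
        (auto simp: edge_path_def pre_digraph.awalk_def pre_digraph.cas.simps oriented_graph_def)
  qed
  then show thesis using that by blast
qed

lemma ray_map_eq_Vertex:
  assumes "ray_map G r t = Vertex u" "0 \<le> t"
  obtains n where "u = ray_verts G r n"
proof -
  obtain e b where d: "r (nat \<lfloor>t\<rfloor>) = (e, b)" by fastforce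
  have "frac t = 0"
    using assms(1) frac_lt_1[of t] by (auto simp: ray_map_def d edge_map_def split: if_splits)
  then have "t = real (nat \<lfloor>t\<rfloor>)" using assms(2) by (simp add: frac_def)
  then have "Vertex u = (Vertex (ray_verts G r (nat \<lfloor>t\<rfloor>)) :: ('a, 'b) graph_point)"
    using assms(1) ray_map_of_nat[of G r "nat \<lfloor>t\<rfloor>"] by (simp add: ray_verts_def)
  then show thesis using that by simp
qed

lemma sym_adj: "sym (adj G)"
proof (rule symI)
  fix u v assume "(u, v) \<in> adj G"
  then obtain e b where d: "e \<in> arcs G" "u = tail (oriented_graph G) (e, b)" "v = head (oriented_graph G) (e, b)"
    by (auto simp: adj_def oriented_graph_def)
  then show "(v, u) \<in> adj G"
    unfolding adj_def by (intro image_eqI[of _ _ "(e, \<not> b)"]) (auto simp: oriented_graph_def)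
qed

lemma adj_subset: "adj G \<subseteq> verts G \<times> verts G"
  unfolding adj_def using oriented_ends_in by blast

lemma infinite_edge_path_adj: "infinite_edge_path G r \<Longrightarrow> (ray_verts G r n, ray_verts G r (Suc n)) \<in> adj G"
  unfolding infinite_edge_path_def adj_def ray_verts_def by (metis (mono_tags, lifting) image_eqI)

lemma ray_verts_end_seqs:
  assumes r: "r \<in> proper_rays G"
  shows "ray_verts G r \<in> end_seqs (verts G) (adj G)"
  unfolding end_seqs_def
proof (intro CollectI conjI allI impI)
  have path: "infinite_edge_path G r" and fin: "\<And>v. finite {n. ray_verts G r n = v}"
    using r by (auto simp: proper_rays_iff)
  note adj = infinite_edge_path_adj[OF path]
  show "range (ray_verts G r) \<subseteq> verts G" using adj adj_subset by blast
  fix F :: "'a set" assume F: "finite F"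
  then have "finite (\<Union>v\<in>F. {n. ray_verts G r n = v})" using fin by blast
  then obtain N where N: "(\<Union>v\<in>F. {n. ray_verts G r n = v}) \<subseteq> {..<N}"
    using finite_nat_iff_bounded by blast
  then have off: "ray_verts G r n \<notin> F" if "n \<ge> N" for n
    using that by (auto simp: subset_iff dest: leD)
  then show "\<forall>\<^sub>F n in sequentially. ray_verts G r n \<notin> F"
    unfolding eventually_sequentially by blast
  have J: "(ray_verts G r N, ray_verts G r n) \<in> joined_off (adj G) F" if "n \<ge> N" for n
    using that
  proof (induction n rule: dec_induct)
    case (step n)
    then show ?case using joined_off_trans joined_off_edge[OF adj off off] by (meson le_SucI)
  qed simp
  show "ev_joined (adj G) F (ray_verts G r) (ray_verts G r)"
    unfolding ev_joined_def
    by (intro exI[of _ N] allI impI joined_off_trans[OF joined_off_sym[OF sym_adj J] J])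
qed

text \<open>\<open>end_rel\<close> asks for one path off \<open>C\<close> between arbitrary vertices
  of the rays, \<open>seq_end_rel\<close> for connections between all late pairs. Within each ray
  late vertices are joined anyway, so one path between late vertices is enough.\<close>

lemma end_rel_iff:
  "(r, r') \<in> end_rel G \<longleftrightarrow> r \<in> proper_rays G \<and> r' \<in> proper_rays G \<and>
     (ray_verts G r, ray_verts G r') \<in> seq_end_rel (verts G) (adj G)" (is "?L \<longleftrightarrow> ?R")
proof
  assume L: ?L
  then have rr: "r \<in> proper_rays G" "r' \<in> proper_rays G" by (auto simp: end_rel_def)
  let ?y = "ray_verts G r" and ?y' = "ray_verts G r'"
  note y = ray_verts_end_seqs[OF rr(1)] ray_verts_end_seqs[OF rr(2)]
  have "ev_joined (adj G) F ?y ?y'" if F: "finite F" for F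
  proof -
    obtain N where N: "\<forall>m\<ge>N. ?y m \<notin> F" "\<forall>m\<ge>N. \<forall>n\<ge>N. (?y m, ?y n) \<in> joined_off (adj G) F"
      by (rule end_seqs_obtain[OF y(1) F F])
    obtain N' where N': "\<forall>m\<ge>N'. ?y' m \<notin> F" "\<forall>m\<ge>N'. \<forall>n\<ge>N'. (?y' m, ?y' n) \<in> joined_off (adj G) F"
      by (rule end_seqs_obtain[OF y(2) F F])
    \<comment> \<open>Adding the initial segments of both rays forces the path to start and end at
      late vertices.\<close>
    let ?F = "(F \<inter> verts G) \<union> ?y ` {..N} \<union> ?y' ` {..N'}"
    have "compactin (realization G) (Vertex ` ?F)"
      using F end_seqs_in[OF y(1)] end_seqs_in[OF y(2)]
      by (intro finite_imp_compactin) (auto simp: topspace_realization graph_points_def)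
    then obtain u p v where p: "edge_path G u p v" "edge_path_image G u p \<inter> Vertex ` ?F = {}"
      and u: "Vertex u \<in> ray_map G r ` {0..}" and v: "Vertex v \<in> ray_map G r' ` {0..}"
      using L unfolding end_rel_def by blast
    have uv: "(u, v) \<in> joined_off (adj G) ?F" by (rule edge_path_joined_off[OF p])
    have "u \<notin> ?F" using p(2) by (auto simp: edge_path_image_def)
    then have "v \<notin> ?F" using joined_off_avoids[OF uv] by blast
    obtain n where n: "u = ?y n" using u ray_map_eq_Vertex by (metis atLeast_iff imageE)
    obtain n' where n': "v = ?y' n'" using v ray_map_eq_Vertex by (metis atLeast_iff imageE)
    have "n \<ge> N" using \<open>u \<notin> ?F\<close> n by (metis UnCI atMost_iff image_eqI nat_le_linear)
    have "n' \<ge> N'" using \<open>v \<notin> ?F\<close> n' by (metis UnCI atMost_iff image_eqI nat_le_linear)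
    have "(u, v) \<in> joined_off (adj G) (F \<inter> verts G)"
      using uv joined_off_antimono[of "F \<inter> verts G" ?F "adj G"] by blast
    then have nn': "(?y n, ?y' n') \<in> joined_off (adj G) F"
      unfolding joined_off_Int[OF adj_subset] n n' .
    show ?thesis
      unfolding ev_joined_def
    proof (intro exI[of _ "max N N'"] allI impI)
      fix k k' assume "max N N' \<le> k" "max N N' \<le> k'"
      then show "(?y k, ?y' k') \<in> joined_off (adj G) F"
        using N(2) N'(2) nn' \<open>n \<ge> N\<close> \<open>n' \<ge> N'\<close> by (meson joined_off_trans max.boundedE)
    qed
  qed
  then show ?R using rr y by (simp add: seq_end_rel_def)
next
  assume R: ?R
  let ?y = "ray_verts G r" and ?y' = "ray_verts G r'"
  have "\<exists>u p v. edge_path G u p v \<and> edge_path_image G u p \<inter> C = {} \<and>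
      Vertex u \<in> ray_map G r ` {0..} \<and> Vertex v \<in> ray_map G r' ` {0..}"
    if C: "compactin (realization G) C" for C
  proof -
    have F: "finite (touched C)" by (rule finite_touched[OF C])
    have y: "?y \<in> end_seqs (verts G) (adj G)" using R by (simp add: ray_verts_end_seqs)
    obtain N where N: "\<forall>m\<ge>N. ?y m \<notin> touched C"
      "\<forall>m\<ge>N. \<forall>n\<ge>N. (?y m, ?y n) \<in> joined_off (adj G) (touched C)"
      by (rule end_seqs_obtain[OF y F F])
    obtain M where M: "\<forall>m\<ge>M. \<forall>n\<ge>M. (?y m, ?y' n) \<in> joined_off (adj G) (touched C)"
      using R F unfolding seq_end_rel_def ev_joined_def by blast
    define n where "n = max M N"
    have "(?y n, ?y' n) \<in> joined_off (adj G) (touched C)" using M by (simp add: n_def)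
    then obtain p where p: "edge_path G (?y n) p (?y' n)"
      "\<And>d. d \<in> set p \<Longrightarrow> tail (oriented_graph G) d \<notin> touched C \<and> head (oriented_graph G) d \<notin> touched C"
      using joined_off_edge_path end_seqs_in[OF y] by blast
    have arcs: "set p \<subseteq> arcs (oriented_graph G)"
      using p(1) by (simp add: edge_path_def pre_digraph.awalk_def)
    have "oriented_edge_map G d t \<notin> C" if "d \<in> set p" for d t
      using arcs that p(2)[OF that] by (intro oriented_edge_avoids) auto
    moreover have "Vertex (?y n) \<notin> C" using N(1) by (auto simp: n_def touched_def)
    ultimately have "edge_path_image G (?y n) p \<inter> C = {}" by (auto simp: edge_path_image_def)
    moreover have "Vertex (ray_verts G q n) \<in> ray_map G q ` {0..}" for q
      by (rule image_eqI[of _ _ "real n"]) (auto simp: ray_map_of_nat ray_verts_def)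
    ultimately show ?thesis using p(1) by blast
  qed
  then show ?L using R by (simp add: end_rel_def)
qed

text \<open>The map sends a ray to its vertices. It hits every class because a walk equivalent to
  the given sequence lifts to a ray, which is proper since the walk leaves each vertex for
  good.\<close>

lemma graph_ends_eqpoll:
  assumes "lf_graph (verts G) (adj G)"
  shows "graph_ends G \<approx> end_seqs (verts G) (adj G) // seq_end_rel (verts G) (adj G)"
  unfolding graph_ends_def
proof (rule quotient_eqpoll[where f = "ray_verts G"])
  show "end_rel G = {(x, y). x \<in> proper_rays G \<and> y \<in> proper_rays G \<and>
      (ray_verts G x, ray_verts G y) \<in> seq_end_rel (verts G) (adj G)}"
    using end_rel_iff by auto
  show "equiv (end_seqs (verts G) (adj G)) (seq_end_rel (verts G) (adj G))"
    by (rule equiv_seq_end_rel[OF sym_adj])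
  show "ray_verts G ` proper_rays G \<subseteq> end_seqs (verts G) (adj G)"
    using ray_verts_end_seqs by blast
  fix y assume y: "y \<in> end_seqs (verts G) (adj G)"
  obtain w where w: "(w, y) \<in> seq_end_rel (verts G) (adj G)" "\<forall>n. (w n, w (Suc n)) \<in> adj G"
    by (rule lf_graph.walk_to_end[OF assms y])
  have "\<exists>d. d \<in> arcs (oriented_graph G) \<and> tail (oriented_graph G) d = w n \<and>
      head (oriented_graph G) d = w (Suc n)" for n
    using w(2)[rule_format, of n] unfolding adj_def by (metis (mono_tags, lifting) imageE prod.inject)
  then obtain r where r: "\<And>n. r n \<in> arcs (oriented_graph G)" "\<And>n. tail (oriented_graph G) (r n) = w n"
    "\<And>n. head (oriented_graph G) (r n) = w (Suc n)"
    by metis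
  have rw: "ray_verts G r = w" using r(2) by (auto simp: ray_verts_def)
  have "finite {n. w n = v}" for v
  proof -
    have "w \<in> end_seqs (verts G) (adj G)" using w(1) by (simp add: seq_end_rel_def)
    then have "\<forall>\<^sub>F n in sequentially. w n \<notin> {v}" by (auto simp: end_seqs_def)
    then obtain N where "\<forall>n\<ge>N. w n \<noteq> v" unfolding eventually_sequentially by auto
    then have "{n. w n = v} \<subseteq> {..<N}" by (auto simp: not_le[symmetric])
    then show ?thesis using finite_subset by blast
  qed
  then have "r \<in> proper_rays G"
    using r by (simp add: proper_rays_iff rw infinite_edge_path_def)
  then show "\<exists>a\<in>proper_rays G. (ray_verts G a, y) \<in> seq_end_rel (verts G) (adj G)"
    using rw w(1) by blast
qed

end

section \<open>The coset graph of a quasi-normal subgroup\<close>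

locale quasi_normal_pair = group G for G (structure) +
  fixes Q
  assumes quasi_normal: "quasi_normal G Q"
begin

lemma subgroup_Q: "subgroup Q G"
  using quasi_normal by (simp add: quasi_normal_def)

lemma Q_carrier: "h \<in> Q \<Longrightarrow> h \<in> carrier G"
  using subgroup.mem_carrier[OF subgroup_Q] .

lemma one_Q: "\<one> \<in> Q"
  using subgroup.one_closed[OF subgroup_Q] .

lemma coset_absorb:
  assumes "g \<in> carrier G" "h \<in> Q"
  shows "(g \<otimes> h) <# Q = g <# Q"
  using l_repr_independence[of "g \<otimes> h" g Q] assms subgroup_Q by (auto simp: l_coset_def)

lemma coset_rep:
  assumes "g <# Q = a <# Q" "g \<in> carrier G"
  obtains h where "h \<in> Q" "g = a \<otimes> h"
proof -
  have "g \<otimes> \<one> \<in> g <# Q" using one_Q by (auto simp: l_coset_def)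
  then have "g \<in> a <# Q" using assms by simp
  then show thesis using that by (auto simp: l_coset_def)
qed

lemma act_coset: "c \<in> carrier G \<Longrightarrow> a \<in> carrier G \<Longrightarrow> c <# (a <# Q) = (c \<otimes> a) <# Q"
  using lcos_m_assoc[of Q c a] subgroup.subset[OF subgroup_Q] by simp

lemma coset_in: "a \<in> carrier G \<Longrightarrow> a <# Q \<in> lcosets Q"
  by (auto simp: LCOSETS_def)

lemma coset_cases:
  assumes "A \<in> lcosets Q"
  obtains a where "a \<in> carrier G" "A = a <# Q"
  using assms by (auto simp: LCOSETS_def)

text \<open>The cosets in \<open>a Q t Q\<close> correspond to the cosets of \<open>t Q t\<inverse> \<inter> Q\<close> in \<open>Q\<close>.\<close>

lemma finite_double_coset:
  assumes a: "a \<in> carrier G" and t: "t \<in> carrier G"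
  shows "finite ((\<lambda>h. (a \<otimes> h \<otimes> t) <# Q) ` Q)"
proof -
  let ?K = "conj_subgroup G t Q \<inter> Q"
  \<comment> \<open>Inversion turns the left coset of \<open>h\<close>, which determines
    \<open>?f h\<close>, into a right coset as counted by \<open>finite_index\<close>: if
    \<open>h' = h \<otimes> k\<close> with \<open>k = t \<otimes> q \<otimes> inv t\<close>, then
    \<open>a \<otimes> h' \<otimes> t = (a \<otimes> h \<otimes> t) \<otimes> q\<close>.\<close>
  let ?f = "\<lambda>h. (a \<otimes> h \<otimes> t) <# Q" and ?g = "\<lambda>h. ?K #> inv h"
  have "finite_index G ?K Q"
    using quasi_normal t by (auto simp: quasi_normal_def commensurator_def)
  then have K: "subgroup ?K (G\<lparr>carrier := Q\<rparr>)" "finite (rcosets\<^bsub>G\<lparr>carrier := Q\<rparr>\<^esub> ?K)"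
    by (auto simp: finite_index_def)
  have "?g ` Q \<subseteq> rcosets\<^bsub>G\<lparr>carrier := Q\<rparr>\<^esub> ?K"
    using subgroup.m_inv_closed[OF subgroup_Q] by (auto simp: RCOSETS_def r_coset_def)
  then have fin: "finite (?g ` Q)" using K(2) finite_subset by blast
  have eq: "?f h = ?f h'" if hQ: "h \<in> Q" "h' \<in> Q" and g: "?g h = ?g h'" for h h'
  proof -
    note h = hQ[THEN Q_carrier]
    have "\<one> \<in> ?K" using subgroup.one_closed[OF K(1)] by simp
    then have "inv h \<in> ?g h" using h by (auto simp: r_coset_def intro!: bexI[of _ \<one>])
    then obtain k where k: "k \<in> ?K" "inv h = k \<otimes> inv h'" using g by (auto simp: r_coset_def)
    then obtain q where q: "q \<in> Q" "k = t \<otimes> q \<otimes> inv t"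
      by (auto simp: conj_subgroup_def l_coset_def r_coset_def)
    note q' = Q_carrier[OF q(1)]
    have "h' = h \<otimes> (inv h \<otimes> h')" using h by (simp add: m_assoc[symmetric])
    also have "inv h \<otimes> h' = k" using k h q t q' by (simp add: m_assoc)
    finally have "h' = h \<otimes> (t \<otimes> q \<otimes> inv t)" using q by simp
    then have "a \<otimes> h' \<otimes> t = (a \<otimes> h \<otimes> t) \<otimes> q" using a h t q' by (simp add: m_assoc)
    then show ?thesis using coset_absorb[of "a \<otimes> h \<otimes> t" q] a h t q by simp
  qed
  have "?f ` Q \<subseteq> (\<lambda>c. ?f (inv_into Q ?g c)) ` ?g ` Q"
    unfolding image_image
  proof (rule image_subsetI)
    fix h assume h: "h \<in> Q"
    then have gh: "?g h \<in> ?g ` Q" by (rule imageI)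
    have "?f h = ?f (inv_into Q ?g (?g h))"
      by (rule eq[OF h inv_into_into[OF gh] f_inv_into_f[OF gh, symmetric]])
    then show "?f h \<in> (\<lambda>h. ?f (inv_into Q ?g (?g h))) ` Q" using h by (rule image_eqI)
  qed
  then show ?thesis using fin finite_subset by blast
qed

text \<open>In an edge from \<open>g\<close> to
  \<open>g \<otimes> h1 \<otimes> s \<otimes> h2\<close>, the factor \<open>h2\<close> is absorbed
  by the terminal coset, and replacing the representative \<open>g\<close> by
  \<open>g \<otimes> h1\<close> removes \<open>h1\<close>.\<close>

lemma adj_coset_graph:
  assumes S: "S \<subseteq> carrier G"
  shows "adj (coset_graph S Q G) =
    (\<Union>g\<in>carrier G. \<Union>s\<in>S. {(g <# Q, (g \<otimes> s) <# Q), ((g \<otimes> s) <# Q, g <# Q)})" (is "_ = ?R")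
proof -
  let ?P = "{(g <# Q, (g \<otimes> s) <# Q) | g s. g \<in> carrier G \<and> s \<in> S}"
  have "(\<lambda>(A, s, B). (A, B)) ` arcs (coset_graph S Q G) = ?P"
  proof
    show "(\<lambda>(A, s, B). (A, B)) ` arcs (coset_graph S Q G) \<subseteq> ?P"
    proof
      fix p assume "p \<in> (\<lambda>(A, s, B). (A, B)) ` arcs (coset_graph S Q G)"
      then obtain g s h1 h2 where *: "g \<in> carrier G" "s \<in> S" "h1 \<in> Q" "h2 \<in> Q"
        "p = (g <# Q, (g \<otimes> h1 \<otimes> s \<otimes> h2) <# Q)"
        by (auto simp: coset_graph_def)
      then have "p = ((g \<otimes> h1) <# Q, ((g \<otimes> h1) \<otimes> s) <# Q)"
        using S Q_carrier by (simp add: coset_absorb subset_iff)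
      then show "p \<in> ?P" using * Q_carrier by blast
    qed
    show "?P \<subseteq> (\<lambda>(A, s, B). (A, B)) ` arcs (coset_graph S Q G)"
    proof
      fix p assume "p \<in> ?P"
      then obtain g s where *: "g \<in> carrier G" "s \<in> S" "p = (g <# Q, (g \<otimes> s) <# Q)" by blast
      then have "g \<otimes> \<one> \<otimes> s \<otimes> \<one> = g \<otimes> s" "g \<otimes> s \<in> carrier G" using S by auto
      then have "(g <# Q, s, (g \<otimes> s) <# Q) \<in> arcs (coset_graph S Q G)"
        unfolding coset_graph_def pre_digraph.select_convs
        using * one_Q by (intro CollectI exI[of _ g] exI[of _ s] exI[of _ "g \<otimes> s"]) blast
      then show "p \<in> (\<lambda>(A, s, B). (A, B)) ` arcs (coset_graph S Q G)"
        unfolding *(3) by (rule image_eqI[rotated]) simp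
    qed
  qed
  moreover have "(\<lambda>e. (tail (coset_graph S Q G) e, head (coset_graph S Q G) e)) = (\<lambda>(A, s, B). (A, B))"
    by (auto simp: coset_graph_def)
  ultimately have "adj (coset_graph S Q G) = ?P \<union> ?P\<inverse>" by (simp only: adj_eq)
  also have "\<dots> = ?R"
  proof (rule Set.set_eqI)
    fix p show "p \<in> ?P \<union> ?P\<inverse> \<longleftrightarrow> p \<in> ?R" by (cases p) blast
  qed
  finally show ?thesis .
qed

lemma wf_coset_graph: "wf_digraph (coset_graph S Q G)"
  by unfold_locales (auto simp: coset_graph_def coset_in)

text \<open>A word for \<open>w\<close> is read off edge by edge from \<open>g\<close>. The length
  bound \<open>L\<close> depends on \<open>w\<close> alone; this uniformity in \<open>g\<close> is
  what the comparison of generating sets rests on.\<close>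

lemma generated_adj:
  assumes S: "S \<subseteq> carrier G" and w: "w \<in> generate G S"
  shows "\<exists>L. \<forall>g\<in>carrier G. (g <# Q, (g \<otimes> w) <# Q) \<in> ((adj (coset_graph S Q G))\<^sup>=) ^^ L"
  using w
proof (induction rule: generate.induct)
  case one
  show ?case by (intro exI[of _ 0]) auto
next
  case (incl s)
  then show ?case by (intro exI[of _ 1]) (auto simp: adj_coset_graph[OF S])
next
  case (inv s)
  have "(g <# Q, (g \<otimes> inv s) <# Q) \<in> adj (coset_graph S Q G)" if g: "g \<in> carrier G" for g
  proof -
    have s: "s \<in> carrier G" using inv S by blast
    then have "(g \<otimes> inv s) \<otimes> s = g" using g by (simp add: m_assoc)
    then show ?thesis
      unfolding adj_coset_graph[OF S] using inv s g
      by (intro UN_I[of "g \<otimes> inv s"] UN_I[of s]) auto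
  qed
  then show ?case by (intro exI[of _ 1]) auto
next
  case (eng u v)
  let ?R = "(adj (coset_graph S Q G))\<^sup>="
  obtain L M where L: "\<forall>g\<in>carrier G. (g <# Q, (g \<otimes> u) <# Q) \<in> ?R ^^ L"
    and M: "\<forall>g\<in>carrier G. (g <# Q, (g \<otimes> v) <# Q) \<in> ?R ^^ M"
    using eng.IH by blast
  have uv: "u \<in> carrier G" "v \<in> carrier G" using eng.hyps generate_incl[OF S] by blast+
  have "(g <# Q, (g \<otimes> (u \<otimes> v)) <# Q) \<in> ?R ^^ (L + M)" if g: "g \<in> carrier G" for g
  proof -
    have "(g <# Q, (g \<otimes> u) <# Q) \<in> ?R ^^ L" using L g by blast
    moreover have "((g \<otimes> u) <# Q, (g \<otimes> u \<otimes> v) <# Q) \<in> ?R ^^ M" using M g uv by blast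
    ultimately show ?thesis using g uv by (auto simp: relpow_add m_assoc)
  qed
  then show ?case by blast
qed

lemma transitive_coset_graph:
  assumes "finite_generating_set G S"
  shows "transitive_graph (lcosets Q) (adj (coset_graph S Q G))"
proof -
  have S: "finite S" "S \<subseteq> carrier G" "generate G S = carrier G"
    using assms by (auto simp: finite_generating_set_def)
  interpret wf_digraph "coset_graph S Q G" by (rule wf_coset_graph)
  let ?E = "adj (coset_graph S Q G)"
  have step: "(g <# Q, (g \<otimes> s) <# Q) \<in> ?E" "((g \<otimes> s) <# Q, g <# Q) \<in> ?E"
    if "g \<in> carrier G" "s \<in> S" for g s
    using that by (auto simp: adj_coset_graph[OF S(2)])
  have E_cases: thesis if "(A, B) \<in> ?E"
    and "\<And>g s. g \<in> carrier G \<Longrightarrow> s \<in> S \<Longrightarrow> A = g <# Q \<Longrightarrow> B = (g \<otimes> s) <# Q \<Longrightarrow> thesis"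
    and "\<And>g s. g \<in> carrier G \<Longrightarrow> s \<in> S \<Longrightarrow> B = g <# Q \<Longrightarrow> A = (g \<otimes> s) <# Q \<Longrightarrow> thesis"
    for A B thesis
    using that unfolding adj_coset_graph[OF S(2)] by blast
  show ?thesis
  proof
    show "?E \<subseteq> (lcosets Q) \<times> (lcosets Q)" using adj_subset by (simp add: coset_graph_def)
    show "sym ?E" by (rule sym_adj)
    show "finite (?E `` {A})" for A
    proof (cases "A \<in> lcosets Q")
      case True
      then obtain a where a: "a \<in> carrier G" "A = a <# Q" by (rule coset_cases)
      \<comment> \<open>Outgoing edges contribute the labels in \<open>S\<close>, incoming edges
        their inverses; each label gives one double coset.\<close>
      have "?E `` {A} \<subseteq> (\<Union>t\<in>S \<union> m_inv G ` S. (\<lambda>h. (a \<otimes> h \<otimes> t) <# Q) ` Q)"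
      proof
        fix B assume "B \<in> ?E `` {A}"
        then have "(A, B) \<in> ?E" by simp
        then show "B \<in> (\<Union>t\<in>S \<union> m_inv G ` S. (\<lambda>h. (a \<otimes> h \<otimes> t) <# Q) ` Q)"
        proof (rule E_cases)
          fix g s assume *: "g \<in> carrier G" "s \<in> S" "A = g <# Q" "B = (g \<otimes> s) <# Q"
          then obtain h where "h \<in> Q" "g = a \<otimes> h" using coset_rep a by metis
          then show ?thesis using * by blast
        next
          fix g s assume *: "g \<in> carrier G" "s \<in> S" "B = g <# Q" "A = (g \<otimes> s) <# Q"
          have s: "s \<in> carrier G" using * S by blast
          obtain h where h: "h \<in> Q" "g \<otimes> s = a \<otimes> h"
            using coset_rep[of "g \<otimes> s" a] a * s by (metis m_closed)
          have "g = g \<otimes> s \<otimes> inv s" using *(1) s by (simp add: m_assoc)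
          then have "g = a \<otimes> h \<otimes> inv s" using h by simp
          then show ?thesis using * h by blast
        qed
      qed
      moreover have "finite (\<Union>t\<in>S \<union> m_inv G ` S. (\<lambda>h. (a \<otimes> h \<otimes> t) <# Q) ` Q)"
        using S a by (intro finite_UN_I finite_double_coset) auto
      ultimately show ?thesis using finite_subset by blast
    next
      case False
      then have "?E `` {A} = {}" using adj_subset by (auto simp: coset_graph_def)
      then show ?thesis by simp
    qed
    fix A B assume "A \<in> lcosets Q" "B \<in> lcosets Q"
    then obtain a b where ab: "a \<in> carrier G" "b \<in> carrier G" "A = a <# Q" "B = b <# Q"
      by (meson coset_cases)
    have "inv a \<otimes> b \<in> generate G S" using ab S by simp
    then obtain L where "(a <# Q, (a \<otimes> (inv a \<otimes> b)) <# Q) \<in> (?E\<^sup>=) ^^ L"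
      using generated_adj[OF S(2)] ab by blast
    then have "(A, B) \<in> (?E\<^sup>=) ^^ L" using ab by (simp add: m_assoc[symmetric])
    then have "(A, B) \<in> (?E\<^sup>=)\<^sup>*" by (rule relpow_imp_rtrancl)
    then show "(A, B) \<in> ?E\<^sup>*" by simp
    \<comment> \<open>Left multiplication by the element taking \<open>a\<close> to
      \<open>b\<close>; it preserves edges because generators multiply on the right.\<close>
    let ?\<phi> = "\<lambda>C. (b \<otimes> inv a) <# C" and ?\<psi> = "\<lambda>C. (a \<otimes> inv b) <# C"
    have act_edge: "(c <# C, c <# D) \<in> ?E" if "(C, D) \<in> ?E" and c: "c \<in> carrier G" for c C D
      using that(1)
    proof (rule E_cases)
      fix g s assume "g \<in> carrier G" "s \<in> S" "C = g <# Q" "D = (g \<otimes> s) <# Q"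
      then show ?thesis using step(1)[of "c \<otimes> g" s] c S by (auto simp: act_coset m_assoc subset_iff)
    next
      fix g s assume "g \<in> carrier G" "s \<in> S" "D = g <# Q" "C = (g \<otimes> s) <# Q"
      then show ?thesis using step(2)[of "c \<otimes> g" s] c S by (auto simp: act_coset m_assoc subset_iff)
    qed
    have inverse: "c <# C \<in> lcosets Q \<and> d <# C \<in> lcosets Q \<and> d <# (c <# C) = C \<and> c <# (d <# C) = C"
      if "C \<in> lcosets Q" "c \<in> carrier G" "d \<in> carrier G" "d \<otimes> c = \<one>" "c \<otimes> d = \<one>" for c d C
      using that(1)
    proof (rule coset_cases)
      fix g assume "g \<in> carrier G" "C = g <# Q"
      then show ?thesis using that by (auto simp: act_coset coset_in m_assoc[symmetric])
    qed
    have ba: "b \<otimes> inv a \<in> carrier G" "a \<otimes> inv b \<in> carrier G"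
      "(a \<otimes> inv b) \<otimes> (b \<otimes> inv a) = \<one>" "(b \<otimes> inv a) \<otimes> (a \<otimes> inv b) = \<one>"
      using ab by (simp_all add: inv_solve_right m_assoc) (simp_all add: m_assoc[symmetric])
    have "?\<phi> A = B" using ab ba by (simp add: act_coset m_assoc)
    then show "\<exists>\<phi> \<psi>. \<phi> A = B \<and>
        (\<forall>C\<in>lcosets Q. \<phi> C \<in> lcosets Q \<and> \<psi> C \<in> lcosets Q \<and> \<psi> (\<phi> C) = C \<and> \<phi> (\<psi> C) = C) \<and>
        (\<forall>C D. (C, D) \<in> ?E \<longrightarrow> (\<phi> C, \<phi> D) \<in> ?E \<and> (\<psi> C, \<psi> D) \<in> ?E)"
      using act_edge ba inverse by (intro exI[of _ ?\<phi>] exI[of _ ?\<psi>] conjI ballI allI impI) auto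
  qed
qed

section \<open>Independence of the generating set\<close>

text \<open>Every element of \<open>T\<close> is a word in \<open>S\<close>, so edges for
  \<open>T\<close> span a bounded distance for \<open>S\<close>. Exchanging the two sets gives
  equality.\<close>

lemma ends_generators_coarser:
  assumes S: "finite_generating_set G S" and T: "finite_generating_set G T"
  shows "end_seqs (lcosets Q) (adj (coset_graph T Q G)) \<subseteq> end_seqs (lcosets Q) (adj (coset_graph S Q G))"
    and "seq_end_rel (lcosets Q) (adj (coset_graph T Q G)) \<subseteq> seq_end_rel (lcosets Q) (adj (coset_graph S Q G))"
proof -
  interpret transitive_graph "lcosets Q" "adj (coset_graph S Q G)"
    by (rule transitive_coset_graph[OF S])
  have SG: "S \<subseteq> carrier G" "generate G S = carrier G" and TG: "finite T" "T \<subseteq> carrier G"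
    using S T by (auto simp: finite_generating_set_def)
  have "\<forall>t\<in>T. \<exists>L. \<forall>g\<in>carrier G. (g \<otimes> t) <# Q \<in> nbhd {g <# Q} L"
    using generated_adj[OF SG(1)] SG(2) TG(2) unfolding nbhd_def by blast
  then obtain L where L: "\<And>t g. t \<in> T \<Longrightarrow> g \<in> carrier G \<Longrightarrow> (g \<otimes> t) <# Q \<in> nbhd {g <# Q} (L t)"
    by metis
  \<comment> \<open>A common upper bound for the finitely many lengths, also valid for empty
    \<open>T\<close>.\<close>
  let ?L = "sum L T"
  have T_step: "(g \<otimes> t) <# Q \<in> nbhd {g <# Q} ?L" if "t \<in> T" "g \<in> carrier G" for t g
    using L[OF that] nbhd_mono[of "L t" ?L] member_le_sum[of t T L] TG that by blast
  \<comment> \<open>Edges traversed backwards are covered by the symmetry of distance.\<close>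
  then have T_step': "g <# Q \<in> nbhd {(g \<otimes> t) <# Q} ?L" if "t \<in> T" "g \<in> carrier G" for t g
    using that nbhd_disjoint_sym by blast
  have near: "B \<in> nbhd {A} ?L" if "(A, B) \<in> adj (coset_graph T Q G)" for A B
    using that T_step T_step' unfolding adj_coset_graph[OF TG(2)] by blast
  show "end_seqs (lcosets Q) (adj (coset_graph T Q G)) \<subseteq> end_seqs (lcosets Q) (adj (coset_graph S Q G))"
    "seq_end_rel (lcosets Q) (adj (coset_graph T Q G)) \<subseteq> seq_end_rel (lcosets Q) (adj (coset_graph S Q G))"
    using ends_coarser near by blast+
qed

lemma graph_ends_coset_graph:
  assumes "finite_generating_set G S"
  shows "graph_ends (coset_graph S Q G) \<approx>
    end_seqs (lcosets Q) (adj (coset_graph S Q G)) // seq_end_rel (lcosets Q) (adj (coset_graph S Q G))"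
proof -
  interpret transitive_graph "lcosets Q" "adj (coset_graph S Q G)"
    by (rule transitive_coset_graph[OF assms])
  have "verts (coset_graph S Q G) = lcosets Q" by (simp add: coset_graph_def)
  then show ?thesis
    using wf_digraph.graph_ends_eqpoll[OF wf_coset_graph, of S] lf_graph_axioms by simp
qed

end

theorem theorem22:
  fixes G :: "('a, 'b) monoid_scheme" and S Q :: "'a set"
  assumes "group G"
    and "finite_generating_set G S"
    and "quasi_normal G Q"
  shows "(finite (graph_ends (coset_graph S Q G)) \<and>
            card (graph_ends (coset_graph S Q G)) \<in> {0, 1, 2}
          \<or> uncountable (graph_ends (coset_graph S Q G)))
       \<and> (\<forall>T. finite_generating_set G T \<longrightarrow>
            graph_ends (coset_graph T Q G) \<approx> graph_ends (coset_graph S Q G))"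
proof (intro conjI allI impI)
  interpret quasi_normal_pair G Q
    using assms by (simp add: quasi_normal_pair_def quasi_normal_pair_axioms_def)
  interpret transitive_graph "lcosets\<^bsub>G\<^esub> Q" "adj (coset_graph S Q G)"
    by (rule transitive_coset_graph[OF assms(2)])
  obtain f where f: "bij_betw f (graph_ends (coset_graph S Q G))
      (end_seqs (lcosets\<^bsub>G\<^esub> Q) (adj (coset_graph S Q G)) // seq_end_rel (lcosets\<^bsub>G\<^esub> Q) (adj (coset_graph S Q G)))"
    using graph_ends_coset_graph[OF assms(2)] unfolding eqpoll_def by blast
  show "finite (graph_ends (coset_graph S Q G)) \<and> card (graph_ends (coset_graph S Q G)) \<in> {0, 1, 2}
      \<or> uncountable (graph_ends (coset_graph S Q G))"
    using number_of_ends bij_betw_finite[OF f] bij_betw_same_card[OF f]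
      countable_image[of "graph_ends (coset_graph S Q G)" f] bij_betw_imp_surj_on[OF f] by metis
  fix T assume T: "finite_generating_set G T"
  have "end_seqs (lcosets\<^bsub>G\<^esub> Q) (adj (coset_graph T Q G)) = end_seqs (lcosets\<^bsub>G\<^esub> Q) (adj (coset_graph S Q G))"
    "seq_end_rel (lcosets\<^bsub>G\<^esub> Q) (adj (coset_graph T Q G)) = seq_end_rel (lcosets\<^bsub>G\<^esub> Q) (adj (coset_graph S Q G))"
    using ends_generators_coarser[OF T assms(2)] ends_generators_coarser[OF assms(2) T] by auto
  then show "graph_ends (coset_graph T Q G) \<approx> graph_ends (coset_graph S Q G)"
    using graph_ends_coset_graph[OF T] eqpoll_sym[OF graph_ends_coset_graph[OF assms(2)]]
    by (simp only:) (rule eqpoll_trans)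
qed

end
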